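(* (1) Let $X=X[w:q]$ be a finite nonempty scalar valued quota complex, and let $v_0$ be a vertex of $X$ of minimal weight. Then $X$ is homotopy equivalent to a bouquet of spheres, in which there is exactly one sphere of dimension $s$ for every face $F$ of $X$ of dimension $s$ such that $v_0\notin F$ and $q-w(v_0)\le w(F)<q$. (2) Let $X=X[\hat w:\hat q]$ be a finite vector valued quota complex of weight dimension $N$. Then $X$ is a union of $N$ scalar valued quota complexes (subcomplexes of $X$). If moreover $X$ has no shell vertices, then $\mathrm{Cat}(X)\le 2N-1$. Thus $\frac{\mathrm{Cat}(X)+1}{2}$, which depends only on the homotopy type of $X$, is a lower bound for the weight dimension $N$ of any vector valued quota system that has no shell vertices and whose quota complex is $X$.
   Context: Let $\mathbb{R}_+$ be the set of positive reals. Scalar quota complex: given a vertex set $V$, a weight function $w:V\to\mathbb{R}_+$ and a quota $q>0$, $X[w:q]$ is the simplicial complex whose faces are the nonempty finite subsets $F=[v_0,\dots,v_n]$ of $V$ (distinct vertices) with $w(F):=\sum_{i=0}^n w(v_i)<q$; a face with $n+1$ vertices has dimension $n$, and the vertices of $X[w:q]$ are the $v\in V$ with $w(v)<q$. Vector valued quota complex: given $\hat w=(w_1,\dots,w_N):V\to\mathbb{R}_+^N$ and $\hat q=(q_1,\dots,q_N)\in\mathbb{R}_+^N$, $X[\hat w:\hat q]$ has as faces the nonempty finite subsets $[v_0,\dots,v_n]$ of $V$ with $\sum_{i=0}^n w_j(v_i)<q_j$ for some $1\le j\le N$. $N$ is called the weight dimension. In the vector case $V$ is finite. Shell vertices: for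 each coordinate $i$ let $v_{min,i}$ be an element of $V$ with $w_i(v_{min,i})$ minimal. A vertex $s$ is a shell vertex if $q_i-w_i(v_{min,i})\le w_i(s)<q_i$ for some coordinate $i$. Bouquet of spheres: a wedge of a (possibly empty) collection of spheres, not necessarily of the same dimension, with $0$-spheres allowed; the empty bouquet is a point. Category: for a topological space $X$ and an integer $n\ge 0$, $\mathrm{Cat}(X)\le n$ means that $X$ can be covered by $n+1$ open sets $U_0,\dots,U_n$ such that each inclusion $U_i\to X$ is null-homotopic; $\mathrm{Cat}(X)$ is the least such $n$ (or $\infty$). *)

theory Defs
  imports "HOL-Analysis.Analysis"
begin

section \<open>Abstract simplicial complexes and their geometric realizations\<close>

text \<open>A complex is the set of its faces; the empty set is not a face.\<close>

definition abstract_complex :: "'v set set \<Rightarrow> bool" where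
  "abstract_complex K \<longleftrightarrow>
     (\<forall>F\<in>K. finite F \<and> F \<noteq> {}) \<and> (\<forall>F\<in>K. \<forall>G. G \<subseteq> F \<and> G \<noteq> {} \<longrightarrow> G \<in> K)"

definition subcomplex :: "'v set set \<Rightarrow> 'v set set \<Rightarrow> bool" where
  "subcomplex L K \<longleftrightarrow> abstract_complex L \<and> L \<subseteq> K"

definition vertices :: "'v set set \<Rightarrow> 'v set" where
  "vertices K = {v. {v} \<in> K}"

definition face_dim :: "'v set \<Rightarrow> nat" where
  "face_dim F = card F - 1"

text \<open>Points are given by barycentric coordinates, extended by 0 outside the vertex set. The
  topology is the one inherited from the product of copies of the real line; it is the usual
  topology of the realization when \<open>K\<close> is finite, and is only used in that case.\<close>

definition realization :: "'v set set \<Rightarrow> ('v \<Rightarrow> real) topology" where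
  "realization K = subtopology (powertop_real UNIV)
     {x. (\<forall>v. 0 \<le> x v) \<and> {v. x v \<noteq> 0} \<in> K \<and> (\<Sum>v | x v \<noteq> 0. x v) = 1}"


section \<open>Quota complexes\<close>

definition scalar_quota_system :: "'v set \<Rightarrow> ('v \<Rightarrow> real) \<Rightarrow> real \<Rightarrow> bool" where
  "scalar_quota_system V w q \<longleftrightarrow> (\<forall>v\<in>V. 0 < w v) \<and> 0 < q"

definition quota_complex :: "'v set \<Rightarrow> ('v \<Rightarrow> real) \<Rightarrow> real \<Rightarrow> 'v set set" where
  "quota_complex V w q = {F. F \<subseteq> V \<and> finite F \<and> F \<noteq> {} \<and> sum w F < q}"

definition is_scalar_quota_complex :: "'v set set \<Rightarrow> bool" where
  "is_scalar_quota_complex K \<longleftrightarrow>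
     (\<exists>V w q. scalar_quota_system V w q \<and> K = quota_complex V w q)"

text \<open>\<open>w j v\<close> is the \<open>j\<close>-th coordinate of the weight of \<open>v\<close>, for \<open>j\<close> in \<open>{1..N}\<close>;
  values at other indices are irrelevant.\<close>

definition vector_quota_system ::
    "nat \<Rightarrow> 'v set \<Rightarrow> (nat \<Rightarrow> 'v \<Rightarrow> real) \<Rightarrow> (nat \<Rightarrow> real) \<Rightarrow> bool" where
  "vector_quota_system N V w q \<longleftrightarrow>
     1 \<le> N \<and> finite V \<and> (\<forall>j\<in>{1..N}. (\<forall>v\<in>V. 0 < w j v) \<and> 0 < q j)"

definition vector_quota_complex ::
    "nat \<Rightarrow> 'v set \<Rightarrow> (nat \<Rightarrow> 'v \<Rightarrow> real) \<Rightarrow> (nat \<Rightarrow> real) \<Rightarrow> 'v set set" where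
  "vector_quota_complex N V w q =
     {F. F \<subseteq> V \<and> finite F \<and> F \<noteq> {} \<and> (\<exists>j\<in>{1..N}. sum (w j) F < q j)}"

definition shell_vertex ::
    "nat \<Rightarrow> 'v set \<Rightarrow> (nat \<Rightarrow> 'v \<Rightarrow> real) \<Rightarrow> (nat \<Rightarrow> real) \<Rightarrow> 'v \<Rightarrow> bool" where
  "shell_vertex N V w q s \<longleftrightarrow>
     s \<in> V \<and> (\<exists>i\<in>{1..N}. q i - Min (w i ` V) \<le> w i s \<and> w i s < q i)"


section \<open>Wedges and bouquets of spheres\<close>

text \<open>The wedge is the quotient of the disjoint sum that identifies all the base points \<open>p i\<close>.
  The common base point is \<open>None\<close>; it is present even if the family is empty, so that the
  empty wedge is a point.\<close>

definition wedge_proj :: "('i \<Rightarrow> 'b) \<Rightarrow> 'i \<times> 'b \<Rightarrow> ('i \<times> 'b) option" where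
  "wedge_proj p z = (if snd z = p (fst z) then None else Some z)"

definition wedge :: "('i \<Rightarrow> 'b topology) \<Rightarrow> ('i \<Rightarrow> 'b) \<Rightarrow> 'i set \<Rightarrow> ('i \<times> 'b) option topology" where
  "wedge X p I = topology (\<lambda>U.
     U \<subseteq> insert None (wedge_proj p ` topspace (sum_topology X I)) \<and>
     openin (sum_topology X I) {z \<in> topspace (sum_topology X I). wedge_proj p z \<in> U})"

lemma openin_wedge:
  "openin (wedge X p I) U \<longleftrightarrow>
     U \<subseteq> insert None (wedge_proj p ` topspace (sum_topology X I)) \<and>
     openin (sum_topology X I) {z \<in> topspace (sum_topology X I). wedge_proj p z \<in> U}"
proof -
  let ?S = "sum_topology X I"
  let ?A = "insert None (wedge_proj p ` topspace ?S)"
  let ?P = "\<lambda>U. U \<subseteq> ?A \<and> openin ?S {z \<in> topspace ?S. wedge_proj p z \<in> U}"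
  have "?P (U \<inter> V)" if "?P U" "?P V" for U V
  proof -
    have "{z \<in> topspace ?S. wedge_proj p z \<in> U \<inter> V} =
          {z \<in> topspace ?S. wedge_proj p z \<in> U} \<inter> {z \<in> topspace ?S. wedge_proj p z \<in> V}"
      by blast
    moreover have "openin ?S ({z \<in> topspace ?S. wedge_proj p z \<in> U} \<inter> {z \<in> topspace ?S. wedge_proj p z \<in> V})"
      using that by (intro openin_Int) simp_all
    ultimately show ?thesis using that by (simp only: le_infI1)
  qed
  moreover have "?P (\<Union>\<U>)" if "\<forall>U\<in>\<U>. ?P U" for \<U>
  proof -
    have "{z \<in> topspace ?S. wedge_proj p z \<in> \<Union>\<U>} =
          (\<Union>U\<in>\<U>. {z \<in> topspace ?S. wedge_proj p z \<in> U})"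
      by blast
    moreover have "openin ?S (\<Union>U\<in>\<U>. {z \<in> topspace ?S. wedge_proj p z \<in> U})"
      using that by (intro openin_Union) auto
    moreover have "\<Union>\<U> \<subseteq> ?A"
      using that by (intro Union_least) simp
    ultimately show ?thesis by (simp only:)
  qed
  ultimately have "istopology ?P"
    unfolding istopology_def by (intro conjI allI impI) simp_all
  then show ?thesis
    by (simp add: wedge_def topology_inverse')
qed

lemma topspace_wedge:
  "topspace (wedge X p I) = insert None (wedge_proj p ` topspace (sum_topology X I))"
proof -
  let ?A = "insert None (wedge_proj p ` topspace (sum_topology X I))"
  have "{z \<in> topspace (sum_topology X I). wedge_proj p z \<in> ?A} = topspace (sum_topology X I)"
    by blast
  then have "openin (wedge X p I) ?A"
    by (simp only: openin_wedge openin_topspace subset_refl simp_thms)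
  then have "?A \<subseteq> topspace (wedge X p I)"
    by (rule openin_subset)
  moreover have "topspace (wedge X p I) \<subseteq> ?A"
    using openin_topspace[of "wedge X p I"] unfolding openin_wedge by (rule conjunct1)
  ultimately show ?thesis
    by (rule equalityI[rotated])
qed

lemma quotient_map_wedge_proj:
  assumes "I \<noteq> {}" "\<And>i. i \<in> I \<Longrightarrow> p i \<in> topspace (X i)"
  shows "quotient_map (sum_topology X I) (wedge X p I) (wedge_proj p)"
proof -
  obtain i where "i \<in> I" using assms(1) by blast
  then have "(i, p i) \<in> topspace (sum_topology X I)" and "wedge_proj p (i, p i) = None"
    using assms(2) by (auto simp: topspace_sum_topology wedge_proj_def)
  then have "None \<in> wedge_proj p ` topspace (sum_topology X I)"
    by (metis imageI)
  then have ts: "wedge_proj p ` topspace (sum_topology X I) = topspace (wedge X p I)"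
    by (auto simp: topspace_wedge)
  show ?thesis
    unfolding quotient_map_def
    using ts by (auto simp: openin_wedge topspace_wedge)
qed

text \<open>The sphere with index \<open>i\<close> has dimension \<open>d i\<close>; its base point is the first unit vector.\<close>

definition sphere_bouquet :: "('i \<Rightarrow> nat) \<Rightarrow> 'i set \<Rightarrow> ('i \<times> (nat \<Rightarrow> real)) option topology" where
  "sphere_bouquet d I = wedge (\<lambda>i. nsphere (d i)) (\<lambda>_ k. if k = 0 then 1 else 0) I"


section \<open>Lusternik--Schnirelmann category\<close>

text \<open>As in \<^const>\<open>contractible_space\<close>, the constant \<open>c\<close> lies in the space automatically unless
  the open set is empty; the empty map is thus null-homotopic, even into the empty space.\<close>

definition null_homotopic_in :: "'a topology \<Rightarrow> 'a set \<Rightarrow> bool" where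
  "null_homotopic_in X U \<longleftrightarrow>
     (\<exists>c. homotopic_with (\<lambda>_. True) (subtopology X U) X id (\<lambda>_. c))"

definition Cat_le :: "'a topology \<Rightarrow> nat \<Rightarrow> bool" where
  "Cat_le X n \<longleftrightarrow>
     (\<exists>U :: nat \<Rightarrow> 'a set. (\<forall>i\<le>n. openin X (U i) \<and> null_homotopic_in X (U i)) \<and>
        topspace X = (\<Union>i\<le>n. U i))"

text \<open>The infimum of the empty set is \<open>\<infinity>\<close>.\<close>

definition Cat :: "'a topology \<Rightarrow> enat" where
  "Cat X = Inf (enat ` {n. Cat_le X n})"

end

(* Let v0 be a vertex of minimal weight. The faces F with F + v0 still below the quota form a cone C
   with apex v0; every other face misses v0, is maximal, and has its boundary in C, because replacing
   one of its vertices by v0 does not increase the weight. Collapsing the contractible C turns the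
   complex into one sphere per remaining face. The homotopy equivalence comes from an explicit
   homotopy of the identity that preserves C and ends in a map constant on C, and all homotopies are
   made of straight segments inside faces.

   Without shell vertices no 0-spheres occur, so each coordinate complex is covered by two open sets,
   a neighbourhood of C and the union of the open cells, whose inclusions are null-homotopic. Each
   subcomplex is a deformation retract of a neighbourhood in the whole complex, so that 2N open sets
   suffice in the vector case. *)

theory Submission
  imports Defs
begin

text \<open>The obstacle is continuity: maps given cell by cell would have to be glued along
  boundaries. Here each map is instead one formula in the barycentric coordinates, valid on the
  whole realization. The main ingredient is the least coordinate over a cell. As cells are maximal
  faces, this function is positive exactly on the open cell and vanishes everywhere else, so a sum
  over all cells has at most one nonzero term at each point and is still visibly continuous. For the
  same reason the map from a cell to its sphere is modelled on stereographic projection: it extends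
  to the complement of the open cell by the constant value at the pole. Collapsing a contractible
  subcomplex is usually justified by the homotopy extension property; the explicit homotopy takes
  its place. For the category bound it suffices that a neighbourhood of a subcomplex maps to the
  subcomplex by a map homotopic, inside the whole complex, to the inclusion: null-homotopic open
  sets can be pulled back along such a map.\<close>

section \<open>Quotients that collapse one subset\<close>

text \<open>Since \<open>h\<close> is constant on \<open>A\<close>, it factors as
  \<open>g \<circ> f\<close>, and \<open>g\<close> is the homotopy inverse. Since every stage of the
  homotopy preserves \<open>A\<close>, it descends to \<open>W\<close>, where it joins the identity
  to \<open>f \<circ> g\<close>.\<close>

lemma homotopy_equivalent_quotient:
  assumes q: "quotient_map X W f"
    and fib: "\<And>x y. \<lbrakk>x \<in> topspace X; y \<in> topspace X; f x = f y\<rbrakk> \<Longrightarrow> x = y \<or> x \<in> A \<and> y \<in> A"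
    and const: "\<And>x y. \<lbrakk>x \<in> A; y \<in> A\<rbrakk> \<Longrightarrow> f x = f y"
    and hom: "homotopic_with (\<lambda>k. k ` A \<subseteq> A) X X id h"
    and h: "\<And>x y. \<lbrakk>x \<in> A; y \<in> A\<rbrakk> \<Longrightarrow> h x = h y"
  shows "X homotopy_equivalent_space W"
proof -
  let ?I = "top_of_set {0..1::real}"
  obtain H where H: "continuous_map (prod_topology ?I X) X H"
    and H0: "\<And>x. H (0, x) = x" and H1: "\<And>x. H (1, x) = h x"
    and HA: "\<And>t. t \<in> {0..1} \<Longrightarrow> (\<lambda>x. H (t, x)) ` A \<subseteq> A"
    using hom unfolding homotopic_with_def by auto
  have fcont: "continuous_map X W f" using q by (rule quotient_imp_continuous_map)
  have ts: "f ` topspace X = topspace W" using q by (rule quotient_imp_surjective_map)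
  have hcont: "continuous_map X X h"
    using homotopic_with_imp_continuous_maps[OF hom] by blast
  obtain g where g: "continuous_map W X g" and gf: "\<And>x. x \<in> topspace X \<Longrightarrow> g (f x) = h x"
    using quotient_map_lift_exists[OF q hcont] fib h by metis
  \<comment> \<open>The product with the interval is again a quotient map because the interval is
    locally compact and Hausdorff; this makes the descended homotopy continuous.\<close>
  have qI: "quotient_map (prod_topology ?I X) (prod_topology ?I W) (\<lambda>(t, x). (t, f x))"
    by (rule quotient_map_prod_right)
      (use q in \<open>auto intro!: compact_imp_locally_compact_space Hausdorff_space_subtopology simp: compact_space_subtopology\<close>)
  have cI: "continuous_map (prod_topology ?I X) W (f \<circ> H)"
    using H fcont by (rule continuous_map_compose)
  have fibI: "(f \<circ> H) z = (f \<circ> H) z'"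
    if zz: "z \<in> topspace (prod_topology ?I X)" "z' \<in> topspace (prod_topology ?I X)"
      "(\<lambda>(t, x). (t, f x)) z = (\<lambda>(t, x). (t, f x)) z'" for z z'
  proof -
    obtain t x x' where z: "z = (t, x)" "z' = (t, x')" "f x = f x'" "t \<in> {0..1}"
      "x \<in> topspace X" "x' \<in> topspace X"
      using zz by (cases z; cases z') auto
    have "f (H (t, x)) = f (H (t, x'))" if "x \<in> A" "x' \<in> A"
      using HA[OF z(4)] that by (intro const) auto
    then show ?thesis using fib[OF z(5,6,3)] z(1,2) by auto
  qed
  obtain K where K: "continuous_map (prod_topology ?I W) W K"
    and Kf: "\<forall>t\<in>{0..1}. \<forall>x\<in>topspace X. K (t, f x) = f (H (t, x))"
  proof (rule quotient_map_lift_exists[OF qI cI])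
    fix z z' assume "z \<in> topspace (prod_topology ?I X)" "z' \<in> topspace (prod_topology ?I X)"
      "(\<lambda>(t, x). (t, f x)) z = (\<lambda>(t, x). (t, f x)) z'"
    then show "(f \<circ> H) z = (f \<circ> H) z'" by (rule fibI)
  next
    fix K assume "continuous_map (prod_topology ?I W) W K"
      "\<And>z. z \<in> topspace (prod_topology ?I X) \<Longrightarrow> K ((\<lambda>(t, x). (t, f x)) z) = (f \<circ> H) z"
    then show ?thesis using that[of K] by force
  qed
  have "homotopic_with (\<lambda>_. True) W W (\<lambda>x. K (0, x)) (\<lambda>x. K (1, x))"
    unfolding homotopic_with_def using K by blast
  then have "homotopic_with (\<lambda>_. True) W W id (f \<circ> g)"
  proof (rule homotopic_with_eq)
    show "id x = K (0, x)" if x: "x \<in> topspace W" for x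
    proof -
      obtain y where "y \<in> topspace X" "x = f y" using x ts by auto
      then show ?thesis using Kf H0 by simp
    qed
    show "(f \<circ> g) x = K (1, x)" if x: "x \<in> topspace W" for x
    proof -
      obtain y where "y \<in> topspace X" "x = f y" using x ts by auto
      then show ?thesis using Kf H1 gf by simp
    qed
  qed auto
  moreover have "homotopic_with (\<lambda>_. True) X X id (g \<circ> f)"
  proof (rule homotopic_with_eq)
    show "homotopic_with (\<lambda>_. True) X X id h" using hom by (rule homotopic_with_mono) simp
  qed (use gf in auto)
  ultimately show ?thesis
    unfolding homotopy_equivalent_space_def using fcont g
    by (auto simp: homotopic_with_sym)
qed

lemma continuous_map_real_Min:
  fixes f :: "'i \<Rightarrow> 'b \<Rightarrow> real"
  assumes "finite I" "I \<noteq> {}" "\<And>i. i \<in> I \<Longrightarrow> continuous_map X euclideanreal (f i)"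
  shows "continuous_map X euclideanreal (\<lambda>x. Min ((\<lambda>i. f i x) ` I))"
  using assms
proof (induction I rule: finite_ne_induct)
  case (insert i I)
  then have "(\<lambda>x. Min ((\<lambda>i. f i x) ` insert i I)) = (\<lambda>x. min (f i x) (Min ((\<lambda>i. f i x) ` I)))"
    by (auto simp: fun_eq_iff)
  then show ?case using insert by (simp add: continuous_map_real_min)
qed simp

section \<open>Pulling back null-homotopic open sets\<close>

text \<open>On the preimage the identity is homotopic to \<open>f \<circ> g\<close>; there
  \<open>g\<close> takes values in \<open>U\<close>, so the null-homotopy of \<open>U\<close> can be
  applied before \<open>f\<close>. That \<open>g\<close> lives only on \<open>N\<close> covers both
  homotopy equivalences and neighbourhoods of subcomplexes.\<close>

lemma null_homotopic_in_preimage: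
  assumes f: "continuous_map X Y f" and g: "continuous_map (subtopology Y N) X g"
    and fg: "homotopic_with (\<lambda>_. True) (subtopology Y N) Y (f \<circ> g) id"
    and U: "null_homotopic_in X U"
  shows "null_homotopic_in Y {y \<in> topspace (subtopology Y N). g y \<in> U}"
proof -
  let ?V = "{y \<in> topspace (subtopology Y N). g y \<in> U}"
  let ?Y = "subtopology Y ?V"
  obtain c where c: "homotopic_with (\<lambda>_. True) (subtopology X U) X id (\<lambda>_. c)"
    using U unfolding null_homotopic_in_def by blast
  have Y: "?Y = subtopology (subtopology Y N) ?V"
    by (auto simp: subtopology_subtopology intro!: arg_cong[where f = "subtopology Y"])
  then have "continuous_map ?Y (subtopology X U) g"
    using continuous_map_from_subtopology[OF g] by (auto simp: continuous_map_in_subtopology)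
  then have "homotopic_with (\<lambda>_. True) ?Y X (id \<circ> g) ((\<lambda>_. c) \<circ> g)"
    by (rule homotopic_with_compose_continuous_map_right[OF c]) simp
  then have "homotopic_with (\<lambda>_. True) ?Y Y (f \<circ> (id \<circ> g)) (f \<circ> ((\<lambda>_. c) \<circ> g))"
    by (rule homotopic_with_compose_continuous_map_left) (use f in auto)
  then have "homotopic_with (\<lambda>_. True) ?Y Y (f \<circ> g) (\<lambda>_. f c)"
    by (simp add: comp_def)
  moreover have "continuous_map ?Y (subtopology Y N) id"
    unfolding Y by (rule continuous_map_from_subtopology) (simp add: id_def)
  then have "homotopic_with (\<lambda>_. True) ?Y Y ((f \<circ> g) \<circ> id) (id \<circ> id)"
    by (rule homotopic_with_compose_continuous_map_right[OF fg]) simp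
  then have "homotopic_with (\<lambda>_. True) ?Y Y id (f \<circ> g)"
    by (simp add: homotopic_with_sym)
  ultimately have "homotopic_with (\<lambda>_. True) ?Y Y id (\<lambda>_. f c)"
    by (rule homotopic_with_trans[rotated])
  then show ?thesis unfolding null_homotopic_in_def by blast
qed

text \<open>Each \<open>X j\<close> contributes \<open>n + 1\<close> open sets, pulled back along
  \<open>g j\<close>. The resulting \<open>k * (n + 1)\<close> sets are numbered from 0, which
  explains the \<open>- 1\<close>.\<close>

lemma Cat_le_cover:
  assumes f: "\<And>j. j < k \<Longrightarrow> continuous_map (X j) Y (f j)"
    and g: "\<And>j. j < k \<Longrightarrow> continuous_map (subtopology Y (N j)) (X j) (g j)"
    and fg: "\<And>j. j < k \<Longrightarrow> homotopic_with (\<lambda>_. True) (subtopology Y (N j)) Y (f j \<circ> g j) id"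
    and N: "\<And>j. j < k \<Longrightarrow> openin Y (N j)" and cover: "topspace Y \<subseteq> (\<Union>j<k. N j)"
    and Cat: "\<And>j. j < k \<Longrightarrow> Cat_le (X j) n" and k: "0 < k"
  shows "Cat_le Y (k * Suc n - 1)"
proof -
  have "\<forall>j. \<exists>U. j < k \<longrightarrow> (\<forall>i\<le>n. openin (X j) (U i) \<and> null_homotopic_in (X j) (U i)) \<and>
      topspace (X j) = (\<Union>i\<le>n. U i)"
    using Cat unfolding Cat_le_def by blast
  then obtain U where U: "\<And>j. j < k \<Longrightarrow> (\<forall>i\<le>n. openin (X j) (U j i) \<and> null_homotopic_in (X j) (U j i)) \<and>
      topspace (X j) = (\<Union>i\<le>n. U j i)"
    by metis
  define O' where "O' j i = {y \<in> topspace (subtopology Y (N j)). g j y \<in> U j i}" for j i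
  have O': "openin Y (O' j i)" "null_homotopic_in Y (O' j i)" if j: "j < k" and i: "i \<le> n" for j i
  proof -
    have "openin (X j) (U j i)" and nh: "null_homotopic_in (X j) (U j i)"
      using U[OF j] i by auto
    then have "openin (subtopology Y (N j)) (O' j i)"
      unfolding O'_def using openin_continuous_map_preimage[OF g[OF j]] by blast
    then show "openin Y (O' j i)" using N[OF j] by (simp add: openin_open_subtopology)
    show "null_homotopic_in Y (O' j i)"
      unfolding O'_def by (rule null_homotopic_in_preimage[OF f[OF j] g[OF j] fg[OF j] nh])
  qed
  \<comment> \<open>The number \<open>j * Suc n + i\<close> encodes the pair \<open>(j, i)\<close>.
    In the bounds below, \<open>0 < k\<close> keeps the subtraction from truncating.\<close>
  let ?O = "\<lambda>i. O' (i div Suc n) (i mod Suc n)"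
  have bound: "i div Suc n < k" "i mod Suc n \<le> n" if "i \<le> k * Suc n - 1" for i
  proof -
    have "i < k * Suc n" using that k by (auto simp: Suc_le_eq[symmetric] le_diff_conv2)
    then show "i div Suc n < k" by (simp only: less_mult_imp_div_less)
    show "i mod Suc n \<le> n" by (simp add: less_Suc_eq_le[symmetric] del: less_Suc_eq_le)
  qed
  have "topspace Y \<subseteq> (\<Union>i\<le>k * Suc n - 1. ?O i)"
  proof
    fix y assume y: "y \<in> topspace Y"
    then obtain j where j: "j < k" "y \<in> N j" using cover by auto
    then have "g j y \<in> topspace (X j)" using g[OF j(1)] y by (auto simp: continuous_map_def)
    then obtain i where i: "i \<le> n" "g j y \<in> U j i" using U[OF j(1)] by auto
    let ?i = "j * Suc n + i"
    have "?i div Suc n = j" "?i mod Suc n = i" using i(1) by (simp_all del: mult_Suc_right)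
    then have "y \<in> ?O ?i" unfolding O'_def using y j i by simp
    moreover have "Suc j * Suc n \<le> k * Suc n" using j(1) by (intro mult_le_mono1) simp
    then have "?i \<le> k * Suc n - 1" using i(1) by simp
    ultimately show "y \<in> (\<Union>i\<le>k * Suc n - 1. ?O i)" by blast
  qed
  moreover have "?O i \<subseteq> topspace Y" if "i \<le> k * Suc n - 1" for i
    using O'(1)[OF bound[OF that]] by (rule openin_subset)
  then have "(\<Union>i\<le>k * Suc n - 1. ?O i) \<subseteq> topspace Y" by (intro UN_least) simp
  ultimately have "topspace Y = (\<Union>i\<le>k * Suc n - 1. ?O i)" by (rule equalityI)
  moreover have "\<forall>i\<le>k * Suc n - 1. openin Y (?O i) \<and> null_homotopic_in Y (?O i)"
    using O'[OF bound] by (intro allI impI conjI)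
  ultimately show ?thesis
    unfolding Cat_le_def by (intro exI[of _ ?O] conjI)
qed

lemma Cat_le_homotopy_equivalent:
  assumes "X homotopy_equivalent_space Y" "Cat_le X n"
  shows "Cat_le Y n"
proof -
  obtain f g where f: "continuous_map X Y f" and g: "continuous_map Y X g"
    and fg: "homotopic_with (\<lambda>_. True) Y Y (f \<circ> g) id"
    using assms(1) unfolding homotopy_equivalent_space_def by blast
  have "Cat_le Y (1 * Suc n - 1)"
    by (rule Cat_le_cover[where X = "\<lambda>_. X" and f = "\<lambda>_. f" and g = "\<lambda>_. g" and N = "\<lambda>_. topspace Y"])
      (use f g fg assms(2) in auto)
  then show ?thesis by simp
qed

lemma Cat_homotopy_equivalent:
  assumes "X homotopy_equivalent_space Y"
  shows "Cat X = Cat Y"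
proof -
  have "Y homotopy_equivalent_space X"
    using assms by (rule homotopy_equivalent_space_sym[THEN iffD1])
  then have "Cat_le X n \<longleftrightarrow> Cat_le Y n" for n
    using assms Cat_le_homotopy_equivalent[of X Y n] Cat_le_homotopy_equivalent[of Y X n] by iprover
  then show ?thesis by (simp add: Cat_def)
qed

section \<open>Collapsing the boundary of a simplex\<close>

text \<open>Inverse stereographic projection applied to the point \<open>Z / M\<close> with \<open>Z i = y i - y 0\<close>
  and \<open>M = min y\<close>, cleared of denominators so that it extends to \<open>M = 0\<close>. The summand
  \<open>(1 - sum y)\<^sup>2\<close> vanishes on the simplex itself; it keeps the denominator positive elsewhere.\<close>

definition simplex_to_sphere :: "nat \<Rightarrow> (nat \<Rightarrow> real) \<Rightarrow> nat \<Rightarrow> real" where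
  "simplex_to_sphere n y k =
     (let M = Min (y ` {..n}); A = (\<Sum>i\<le>n. (y i - y 0)\<^sup>2) + (1 - sum y {..n})\<^sup>2
      in (if k = 0 then A - M\<^sup>2 else if k \<le> n then 2 * M * (y k - y 0) else 0) / (A + M\<^sup>2))"

lemma simplex_to_sphere_cong:
  assumes "\<And>i. i \<le> n \<Longrightarrow> y i = z i"
  shows "simplex_to_sphere n y = simplex_to_sphere n z"
proof
  fix k
  have "y ` {..n} = z ` {..n}" "sum y {..n} = sum z {..n}"
    "(\<Sum>i\<le>n. (y i - y 0)\<^sup>2) = (\<Sum>i\<le>n. (z i - z 0)\<^sup>2)"
    using assms by (auto intro!: sum.cong image_cong)
  then show "simplex_to_sphere n y k = simplex_to_sphere n z k"
    using assms[of k] assms[of 0] by (cases "k \<le> n") (simp_all add: simplex_to_sphere_def Let_def)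
qed

text \<open>If the first two summands vanish, all coordinates are equal and add up to 1, so their
  common value, which is also the minimum, is not 0.\<close>

lemma simplex_to_sphere_denominator_pos:
  fixes y :: "nat \<Rightarrow> real"
  shows "0 < (\<Sum>i\<le>n. (y i - y 0)\<^sup>2) + (1 - sum y {..n})\<^sup>2 + (Min (y ` {..n}))\<^sup>2"
proof -
  have nn: "0 \<le> (\<Sum>i\<le>n. (y i - y 0)\<^sup>2)" by (rule sum_nonneg) (rule zero_le_power2)
  consider i where "i \<le> n" "y i \<noteq> y 0" | "sum y {..n} \<noteq> 1"
    | c where "\<forall>i\<in>{..n}. y i = c" "sum y {..n} = 1"
    by blast
  then show ?thesis
  proof cases
    case 1
    then have "0 < (\<Sum>i\<le>n. (y i - y 0)\<^sup>2)" by (intro sum_pos2[of _ i]) auto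
    then show ?thesis by (intro add_pos_nonneg zero_le_power2)
  next
    case 2
    then have "0 < (1 - sum y {..n})\<^sup>2" by simp
    with nn show ?thesis by (intro add_pos_nonneg add_nonneg_pos zero_le_power2)
  next
    case 3
    then have "sum y {..n} = (\<Sum>i\<le>n. c)" by (intro sum.cong) auto
    with 3 have "c \<noteq> 0" by auto
    moreover have "y ` {..n} = {c}" using 3(1) by auto
    then have "Min (y ` {..n}) = c" by simp
    ultimately have "0 < (Min (y ` {..n}))\<^sup>2" by (simp only: zero_less_power2 not_False_eq_True)
    with nn show ?thesis by (intro add_nonneg_pos add_nonneg_nonneg zero_le_power2)
  qed
qed

lemma simplex_to_sphere_boundary:
  assumes "Min (y ` {..n}) = 0"
  shows "simplex_to_sphere n y = (\<lambda>k. if k = 0 then 1 else 0)"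
proof
  fix k
  show "simplex_to_sphere n y k = (if k = 0 then 1 else 0)"
    using simplex_to_sphere_denominator_pos[where y = y and n = n] assms by (simp add: simplex_to_sphere_def Let_def)
qed

text \<open>The norm is 1 by the identity \<open>(B - M^2)^2 + 4 * M^2 * B = (B + M^2)^2\<close>.
  The alternative with minimum 0 is for points outside the open cell, whose coordinates over the
  cell need not add up to 1.\<close>

lemma simplex_to_sphere_in_nsphere:
  assumes "Min (y ` {..n}) = 0 \<or> sum y {..n} = 1"
  shows "simplex_to_sphere n y \<in> topspace (nsphere n)"
proof (cases "Min (y ` {..n}) = 0")
  case True
  then show ?thesis by (simp only: simplex_to_sphere_boundary in_topspace_nsphere)
next
  case False
  then have s: "sum y {..n} = 1" using assms by simp
  define M where "M = Min (y ` {..n})"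
  define B where "B = (\<Sum>i\<le>n. (y i - y 0)\<^sup>2)"
  have pos: "B + M\<^sup>2 \<noteq> 0" using simplex_to_sphere_denominator_pos[where y = y and n = n] s by (simp add: B_def M_def)
  have B': "B = (\<Sum>i\<in>{1..n}. (y i - y 0)\<^sup>2)"
    unfolding B_def by (simp add: atMost_atLeast0 sum.atLeast_Suc_atMost)
  let ?p = "simplex_to_sphere n y"
  have p: "?p k = (if k = 0 then B - M\<^sup>2 else if k \<le> n then 2 * M * (y k - y 0) else 0) / (B + M\<^sup>2)" for k
    using s by (simp add: simplex_to_sphere_def B_def M_def Let_def)
  have "(\<Sum>i\<le>n. (?p i)\<^sup>2) = (?p 0)\<^sup>2 + (\<Sum>i\<in>{1..n}. (?p i)\<^sup>2)"
    by (simp add: atMost_atLeast0 sum.atLeast_Suc_atMost)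
  also have "(\<Sum>i\<in>{1..n}. (?p i)\<^sup>2) = (\<Sum>i\<in>{1..n}. (2 * M / (B + M\<^sup>2))\<^sup>2 * (y i - y 0)\<^sup>2)"
    by (intro sum.cong) (auto simp: p power_mult_distrib power_divide)
  also have "\<dots> = (2 * M / (B + M\<^sup>2))\<^sup>2 * B"
    by (simp add: B' sum_distrib_left)
  also have "(?p 0)\<^sup>2 = ((B - M\<^sup>2) / (B + M\<^sup>2))\<^sup>2" by (simp add: p)
  also have "((B - M\<^sup>2) / (B + M\<^sup>2))\<^sup>2 + (2 * M / (B + M\<^sup>2))\<^sup>2 * B
      = ((B - M\<^sup>2)\<^sup>2 + (2 * M)\<^sup>2 * B) / (B + M\<^sup>2)\<^sup>2"
    by (simp add: power_divide add_divide_distrib)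
  also have "(B - M\<^sup>2)\<^sup>2 + (2 * M)\<^sup>2 * B = (B + M\<^sup>2)\<^sup>2" by algebra
  finally have "(\<Sum>i\<le>n. (?p i)\<^sup>2) = 1" using pos by simp
  moreover have "?p i = 0" if "n < i" for i using that by (simp add: p)
  ultimately show ?thesis by (simp add: nsphere)
qed

text \<open>Dividing by \<open>1 - p 0\<close> is stereographic projection from the base point; it
  recovers the differences of coordinates relative to the minimum. For \<open>k = 0\<close> the
  equation is vacuous.\<close>

lemma simplex_to_sphere_interior:
  assumes "0 < Min (y ` {..n})" "sum y {..n} = 1"
  shows "simplex_to_sphere n y 0 < 1"
    and "k \<le> n \<Longrightarrow> simplex_to_sphere n y k / (1 - simplex_to_sphere n y 0) =
           (if k = 0 then simplex_to_sphere n y 0 / (1 - simplex_to_sphere n y 0)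
            else (y k - y 0) / Min (y ` {..n}))"
proof -
  define M where "M = Min (y ` {..n})"
  define B where "B = (\<Sum>i\<le>n. (y i - y 0)\<^sup>2)"
  let ?p = "simplex_to_sphere n y"
  have p: "?p k = (if k = 0 then B - M\<^sup>2 else if k \<le> n then 2 * M * (y k - y 0) else 0) / (B + M\<^sup>2)" for k
    using assms(2) by (simp add: simplex_to_sphere_def B_def M_def Let_def)
  have M: "0 < M" using assms(1) by (simp add: M_def)
  have "0 \<le> B" by (simp add: B_def sum_nonneg)
  then have pos: "0 < B + M\<^sup>2" using M by (intro add_nonneg_pos) auto
  have 1: "1 - ?p 0 = 2 * M\<^sup>2 / (B + M\<^sup>2)" using pos by (simp add: p field_simps)
  moreover have "0 < 2 * M\<^sup>2 / (B + M\<^sup>2)" using pos M by simp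
  ultimately show "?p 0 < 1" by linarith
  show "?p k / (1 - ?p 0) = (if k = 0 then ?p 0 / (1 - ?p 0) else (y k - y 0) / Min (y ` {..n}))"
    if "k \<le> n"
  proof (cases "k = 0")
    case False
    then have "?p k / (1 - ?p 0) = (2 * M * (y k - y 0) / (B + M\<^sup>2)) / (2 * M\<^sup>2 / (B + M\<^sup>2))"
      using that by (simp add: 1) (simp add: p)
    also have "\<dots> = (y k - y 0) / M" using pos M by (simp add: power2_eq_square)
    finally show ?thesis using False by (simp add: M_def)
  qed simp
qed

text \<open>Stereographic projection shows that \<open>y / M\<close> and \<open>y' / M'\<close>
  differ by a constant, where \<open>M\<close> and \<open>M'\<close> are the minima. Both vectors
  have least entry 1, so the constant is 0; their sums \<open>1 / M\<close> and
  \<open>1 / M'\<close> then agree.\<close>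

lemma simplex_to_sphere_inj:
  assumes "0 < Min (y ` {..n})" "sum y {..n} = 1" "0 < Min (y' ` {..n})" "sum y' {..n} = 1"
    and eq: "simplex_to_sphere n y = simplex_to_sphere n y'" and i: "i \<le> n"
  shows "y i = y' i"
proof -
  have diff: "u j / Mu = v j / Mv + (u 0 / Mu - v 0 / Mv)"
    if "Mu = Min (u ` {..n})" "Mv = Min (v ` {..n})" "0 < Mu" "0 < Mv" "sum u {..n} = 1" "sum v {..n} = 1"
      "simplex_to_sphere n u = simplex_to_sphere n v" "j \<le> n" for u v :: "nat \<Rightarrow> real" and j Mu Mv
  proof (cases "j = 0")
    case False
    then have "(u j - u 0) / Mu = (v j - v 0) / Mv"
      using simplex_to_sphere_interior(2)[of u n j] simplex_to_sphere_interior(2)[of v n j] that by simp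
    then show ?thesis by (simp add: diff_divide_distrib)
  qed simp
  \<comment> \<open>Evaluated at an index where \<open>u\<close> is least: there
    \<open>u j / Mu\<close> is 1 and \<open>v j / Mv\<close> is at least 1. Exchanging the roles of
    \<open>u\<close> and \<open>v\<close> yields the reverse inequality.\<close>
  have le: "u 0 / Mu - v 0 / Mv \<le> 0"
    if h: "Mu = Min (u ` {..n})" "Mv = Min (v ` {..n})" "0 < Mu" "0 < Mv" "sum u {..n} = 1" "sum v {..n} = 1"
      "simplex_to_sphere n u = simplex_to_sphere n v" for u v :: "nat \<Rightarrow> real" and Mu Mv
  proof -
    have "Mu \<in> u ` {..n}" unfolding h by (intro Min_in) auto
    then obtain j where j: "j \<le> n" "u j = Mu" by auto
    have "Mv \<le> v j" using j unfolding h by (intro Min_le) auto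
    then have "1 \<le> v j / Mv" using h(4) by simp
    moreover have "u j / Mu = 1" using j(2) h(3) by simp
    ultimately show ?thesis using diff[OF h j(1)] by linarith
  qed
  define M M' where "M = Min (y ` {..n})" and "M' = Min (y' ` {..n})"
  have pos: "0 < M" "0 < M'" using assms by (simp_all add: M_def M'_def)
  have "y 0 / M - y' 0 / M' = 0"
    using le[OF M_def M'_def pos assms(2,4) eq] le[OF M'_def M_def pos(2,1) assms(4,2) eq[symmetric]]
    by linarith
  then have r: "y j / M = y' j / M'" if "j \<le> n" for j
    using diff[OF M_def M'_def pos assms(2,4) eq that] by simp
  have "1 / M = (\<Sum>j\<le>n. y j / M)" using assms by (simp flip: sum_divide_distrib)
  also have "\<dots> = (\<Sum>j\<le>n. y' j / M')" by (intro sum.cong) (auto simp: r)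
  also have "\<dots> = 1 / M'" using assms by (simp flip: sum_divide_distrib)
  finally have "M = M'" using pos by simp
  then show ?thesis using r[OF i] pos by simp
qed

lemma simplex_to_sphere_surj:
  assumes p: "p \<in> topspace (nsphere n)" and ne: "p \<noteq> (\<lambda>k. if k = 0 then 1 else 0)"
  obtains y where "\<And>i. 0 < y i" "sum y {..n} = 1" "simplex_to_sphere n y = p"
proof -
  have p1: "(\<Sum>i\<le>n. (p i)\<^sup>2) = 1" and p0: "\<And>i. n < i \<Longrightarrow> p i = 0"
    using p by (auto simp: nsphere)
  have sp: "(p 0)\<^sup>2 + (\<Sum>i\<in>{1..n}. (p i)\<^sup>2) = 1"
    using p1 by (simp add: atMost_atLeast0 sum.atLeast_Suc_atMost)
  have nn: "0 \<le> (\<Sum>i\<in>{1..n}. (p i)\<^sup>2)" by (simp add: sum_nonneg)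
  have "p 0 \<noteq> 1"
  proof
    assume "p 0 = 1"
    then have "(\<Sum>i\<in>{1..n}. (p i)\<^sup>2) = 0" using sp by simp
    then have "p i = 0" if "1 \<le> i" "i \<le> n" for i using that by (auto simp: sum_nonneg_eq_0_iff)
    then have "p = (\<lambda>k. if k = 0 then 1 else 0)"
      using p0 \<open>p 0 = 1\<close> by (metis One_nat_def Suc_leI not_le not_gr_zero)
    then show False using ne by contradiction
  qed
  moreover have "(p 0)\<^sup>2 \<le> 1" using sp nn by linarith
  then have "p 0 \<le> 1" by (simp add: abs_square_le_1)
  ultimately have lt: "p 0 < 1" by simp
  define z where "z i = (if i = 0 \<or> n < i then 0 else p i / (1 - p 0))" for i
  define mz where "mz = Min (z ` {..n})"
  \<comment> \<open>The stereographic coordinates \<open>z\<close> fix \<open>y\<close> only up to a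
    common shift and a scale. The shift makes the least entry 1; division by \<open>R\<close> makes
    the sum 1 and the minimum \<open>1 / R\<close>. The value 1 beyond \<open>n\<close> makes
    \<open>y\<close> positive everywhere.\<close>
  define r where "r i = (if i \<le> n then 1 + z i - mz else 1)" for i
  define R where "R = sum r {..n}"
  define y where "y i = r i / R" for i
  have "mz \<le> z i" if "i \<le> n" for i using that unfolding mz_def by (intro Min_le) auto
  then have rge: "1 \<le> r i" for i unfolding r_def by auto
  have "0 < R" unfolding R_def using rge by (intro sum_pos) (auto intro: less_le_trans[OF zero_less_one])
  have y: "\<And>i. 0 < y i"
    unfolding y_def using \<open>0 < R\<close> rge by (auto intro: divide_pos_pos less_le_trans[OF zero_less_one])
  have s: "sum y {..n} = 1" unfolding y_def using \<open>0 < R\<close> by (simp flip: sum_divide_distrib R_def)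
  have M: "Min (y ` {..n}) = 1 / R"
  proof (rule Min_eqI)
    have "mz \<in> z ` {..n}" unfolding mz_def by (intro Min_in) auto
    then obtain j where "j \<le> n" "z j = mz" by auto
    then have "j \<le> n" "y j = 1 / R" by (simp_all add: y_def r_def)
    then show "1 / R \<in> y ` {..n}" by (metis atMost_iff imageI)
  qed (use rge \<open>0 < R\<close> in \<open>auto simp: y_def divide_right_mono\<close>)
  have Z: "y i - y 0 = z i / R" if "i \<le> n" for i
  proof -
    have "z 0 = 0" by (simp add: z_def)
    then have "r i - r 0 = z i" using that by (simp add: r_def)
    then show ?thesis by (simp add: y_def flip: diff_divide_distrib)
  qed
  \<comment> \<open>The squared norm of the stereographic coordinates. It equals
    \<open>(1 + p 0) / (1 - p 0)\<close>, so that \<open>p 0 = (b - 1) / (b + 1)\<close>.\<close>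
  define b where "b = (\<Sum>i\<in>{1..n}. (z i)\<^sup>2)"
  have "b = (\<Sum>i\<in>{1..n}. (p i)\<^sup>2 / (1 - p 0)\<^sup>2)"
    unfolding b_def by (intro sum.cong) (auto simp: z_def power_divide)
  also have "\<dots> = (1 - (p 0)\<^sup>2) / (1 - p 0)\<^sup>2"
    unfolding sum_divide_distrib[symmetric] using sp by (intro arg_cong2[where f = "(/)"]) auto
  finally have "b = (1 - (p 0)\<^sup>2) / (1 - p 0)\<^sup>2" .
  moreover have "1 - (p 0)\<^sup>2 = (1 + p 0) * (1 - p 0)" "(1 - p 0)\<^sup>2 = (1 - p 0) * (1 - p 0)"
    by algebra+
  ultimately have b: "b = (1 + p 0) / (1 - p 0)"
    using lt by simp
  have "(\<Sum>i\<le>n. (y i - y 0)\<^sup>2) = (\<Sum>i\<in>{1..n}. (y i - y 0)\<^sup>2)"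
    by (simp add: atMost_atLeast0 sum.atLeast_Suc_atMost)
  also have "\<dots> = (\<Sum>i\<in>{1..n}. (z i)\<^sup>2 / R\<^sup>2)"
    by (intro sum.cong) (auto simp: Z power_divide)
  also have "\<dots> = b / R\<^sup>2" by (simp add: b_def sum_divide_distrib)
  finally have B: "(\<Sum>i\<le>n. (y i - y 0)\<^sup>2) = b / R\<^sup>2" .
  have "0 < b + 1" unfolding b using lt by (simp add: field_simps)
  have D: "b / R\<^sup>2 + (1 / R)\<^sup>2 = (b + 1) / R\<^sup>2" by (simp add: power_divide add_divide_distrib)
  have "simplex_to_sphere n y k = p k" for k
  proof -
    consider "k = 0" | "1 \<le> k" "k \<le> n" | "n < k" by linarith
    then show ?thesis
    proof cases
      case 1
      have "simplex_to_sphere n y k = ((b - 1) / R\<^sup>2) / ((b + 1) / R\<^sup>2)"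
        using 1 by (simp add: simplex_to_sphere_def Let_def B s M D[symmetric])
          (simp add: power_divide diff_divide_distrib)
      also have "\<dots> = (b - 1) / (b + 1)" using \<open>0 < R\<close> by simp
      also have "\<dots> = p 0" unfolding b using lt by (simp add: field_simps)
      finally show ?thesis using 1 by simp
    next
      case 2
      then have "simplex_to_sphere n y k = (2 * (1 / R) * (y k - y 0)) / ((b + 1) / R\<^sup>2)"
        by (simp add: simplex_to_sphere_def Let_def B s M D[symmetric])
      also have "\<dots> = (2 * z k / R\<^sup>2) / ((b + 1) / R\<^sup>2)"
        using 2 by (simp only: Z) (simp add: power2_eq_square)
      also have "\<dots> = 2 * z k / (b + 1)" using \<open>0 < R\<close> by simp
      also have "\<dots> = p k" unfolding b using lt 2 by (simp add: field_simps z_def)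
      finally show ?thesis .
    qed (use p0 in \<open>simp add: simplex_to_sphere_def\<close>)
  qed
  then show ?thesis using that y s by blast
qed

lemma continuous_map_simplex_to_sphere:
  assumes c: "\<And>i. i \<le> n \<Longrightarrow> continuous_map X euclideanreal (\<lambda>x. f x i)"
    and f: "\<And>x. x \<in> topspace X \<Longrightarrow> Min (f x ` {..n}) = 0 \<or> sum (f x) {..n} = 1"
  shows "continuous_map X (nsphere n) (\<lambda>x. simplex_to_sphere n (f x))"
proof -
  have m: "continuous_map X euclideanreal (\<lambda>x. Min (f x ` {..n}))"
    by (rule continuous_map_real_Min) (use c in auto)
  have "continuous_map X euclideanreal (\<lambda>x. simplex_to_sphere n (f x) k)" for k
  proof -
    have "continuous_map X euclideanreal (\<lambda>x. if k = 0 then (\<Sum>i\<le>n. (f x i - f x 0)\<^sup>2) + (1 - sum (f x) {..n})\<^sup>2 - (Min (f x ` {..n}))\<^sup>2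
      else if k \<le> n then 2 * Min (f x ` {..n}) * (f x k - f x 0) else 0)"
      by (cases "k = 0"; cases "k \<le> n") (auto intro!: continuous_intros m c)
    then show ?thesis
      unfolding simplex_to_sphere_def Let_def
      using simplex_to_sphere_denominator_pos
      by (intro continuous_map_real_divide) (auto intro!: continuous_intros m c simp: less_imp_neq[symmetric])
  qed
  then show ?thesis
    using simplex_to_sphere_in_nsphere f
    by (auto simp: nsphere continuous_map_in_subtopology continuous_map_componentwise_UNIV)
qed

section \<open>Maps into realizations\<close>

lemma abstract_complex_subset:
  "\<lbrakk>abstract_complex K; F \<in> K; G \<subseteq> F; G \<noteq> {}\<rbrakk> \<Longrightarrow> G \<in> K"
  unfolding abstract_complex_def by blast

text \<open>Describes the realization as the union of its closed simplices. Any face containing the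
  support will do, so membership can be checked without computing the exact support.\<close>

lemma in_topspace_realization:
  assumes "abstract_complex K"
  shows "x \<in> topspace (realization K) \<longleftrightarrow>
    (\<exists>F\<in>K. (\<forall>v. 0 \<le> x v) \<and> (\<forall>v. v \<notin> F \<longrightarrow> x v = 0) \<and> sum x F = 1)"
proof
  assume "x \<in> topspace (realization K)"
  then show "\<exists>F\<in>K. (\<forall>v. 0 \<le> x v) \<and> (\<forall>v. v \<notin> F \<longrightarrow> x v = 0) \<and> sum x F = 1"
    by (intro bexI[of _ "{v. x v \<noteq> 0}"]) (auto simp: realization_def)
next
  assume "\<exists>F\<in>K. (\<forall>v. 0 \<le> x v) \<and> (\<forall>v. v \<notin> F \<longrightarrow> x v = 0) \<and> sum x F = 1"
  then obtain F where F: "F \<in> K" "\<forall>v. 0 \<le> x v" "\<forall>v. v \<notin> F \<longrightarrow> x v = 0" "sum x F = 1" by blast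
  have fin: "finite F" using F(1) assms unfolding abstract_complex_def by blast
  have "sum x F = sum x {v. x v \<noteq> 0}"
    by (rule sum.mono_neutral_right) (use fin F(3) in auto)
  then have s: "sum x {v. x v \<noteq> 0} = 1" using F(4) by simp
  then have "{v. x v \<noteq> 0} \<noteq> {}" by (metis sum.empty zero_neq_one)
  moreover have "{v. x v \<noteq> 0} \<subseteq> F" using F(3) by blast
  ultimately have "{v. x v \<noteq> 0} \<in> K" using F(1) assms unfolding abstract_complex_def by blast
  then show "x \<in> topspace (realization K)" using s F(2) by (simp add: realization_def)
qed

lemma realization_mono:
  assumes "L \<subseteq> K"
  shows "topspace (realization L) \<subseteq> topspace (realization K)"
  using assms by (auto simp: realization_def)

lemma continuous_map_into_realization:
  "continuous_map X (realization K) f \<longleftrightarrow>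
     (\<forall>v. continuous_map X euclideanreal (\<lambda>x. f x v)) \<and> f \<in> topspace X \<rightarrow> topspace (realization K)"
  by (simp add: realization_def continuous_map_in_subtopology continuous_map_componentwise_UNIV)

lemma continuous_map_barycentric_coordinate:
  "continuous_map (realization K) euclideanreal (\<lambda>x. x v)"
  unfolding realization_def
  by (intro continuous_map_from_subtopology continuous_map_product_projection) simp

text \<open>There are finitely many closed simplices, and each is a closed subset of a cube that is
  compact by Tychonoff's theorem.\<close>

lemma compact_space_realization:
  fixes K :: "'a set set"
  assumes K: "abstract_complex K" and fin: "finite K"
  shows "compact_space (realization K)"
proof -
  let ?P = "powertop_real (UNIV :: 'a set)"
  let ?s = "\<lambda>F. {x :: 'a \<Rightarrow> real. (\<forall>v. 0 \<le> x v) \<and> (\<forall>v. v \<notin> F \<longrightarrow> x v = 0) \<and> sum x F = 1}"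
  have "compactin ?P (?s F)" if "F \<in> K" for F
  proof (rule closed_compactin)
    have finF: "finite F" using that K unfolding abstract_complex_def by blast
    show "compactin ?P (PiE UNIV (\<lambda>_. {0..1}))"
      by (simp add: compactin_PiE)
    show "?s F \<subseteq> PiE UNIV (\<lambda>_. {0..1})"
    proof
      fix x assume x: "x \<in> ?s F"
      have "x v \<le> 1" for v
      proof (cases "v \<in> F")
        case True
        then have "x v \<le> sum x F" using x finF by (intro member_le_sum[where f = x]) auto
        then show ?thesis using x by simp
      qed (use x in auto)
      then show "x \<in> PiE UNIV (\<lambda>_. {0..1})" using x by auto
    qed
    have "closed (?s F)"
      by (intro closed_Collect_conj closed_Collect_all closed_Collect_imp closed_Collect_le
          closed_Collect_eq open_Collect_const continuous_intros continuous_on_product_coordinates)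
    then show "closedin ?P (?s F)" by (simp add: euclidean_product_topology)
  qed
  then have "compactin ?P (\<Union>(?s ` K))" using fin by (intro compactin_Union) auto
  moreover have "\<Union>(?s ` K) = topspace (realization K)"
    by (intro set_eqI) (simp add: in_topspace_realization[OF K])
  ultimately have "compactin ?P (topspace (realization K))" by simp
  then show ?thesis by (simp add: realization_def compact_space_subtopology)
qed

text \<open>The two values lie in a common closed simplex, which is convex. The property
  \<open>P\<close> is carried along because the collapse requires that every stage preserve the
  cone.\<close>

lemma homotopic_with_segment:
  assumes K: "abstract_complex K"
    and f: "continuous_map Y (realization K) f" and g: "continuous_map Y (realization K) g"
    and face: "\<And>y. y \<in> topspace Y \<Longrightarrow> \<exists>F\<in>K. \<forall>v. v \<notin> F \<longrightarrow> f y v = 0 \<and> g y v = 0"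
    and P: "\<And>t. t \<in> {0..1} \<Longrightarrow> P (\<lambda>y v. (1 - t) * f y v + t * g y v)"
  shows "homotopic_with P Y (realization K) f g"
proof -
  let ?h = "\<lambda>(t::real, y) v. (1 - t) * f y v + t * g y v"
  have fv: "continuous_map Y euclideanreal (\<lambda>y. f y v)" and gv: "continuous_map Y euclideanreal (\<lambda>y. g y v)" for v
    using f g by (simp_all add: continuous_map_into_realization)
  have "continuous_map (prod_topology (top_of_set {0..1}) Y) euclideanreal (\<lambda>z. ?h z v)" for v
  proof -
    have t: "continuous_map (prod_topology (top_of_set {0..1}) Y) euclideanreal fst"
      using continuous_map_fst continuous_map_in_subtopology by blast
    have "continuous_map (prod_topology (top_of_set {0..1::real}) Y) euclideanreal (\<lambda>z. f (snd z) v)"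
      "continuous_map (prod_topology (top_of_set {0..1::real}) Y) euclideanreal (\<lambda>z. g (snd z) v)"
      using continuous_map_compose[OF continuous_map_snd fv] continuous_map_compose[OF continuous_map_snd gv]
      by (simp_all add: o_def)
    with t show ?thesis by (auto simp: case_prod_beta intro!: continuous_intros)
  qed
  moreover have "?h (t, y) \<in> topspace (realization K)" if ty: "t \<in> {0..1}" "y \<in> topspace Y" for t y
  proof -
    obtain F where F: "F \<in> K" "\<forall>v. v \<notin> F \<longrightarrow> f y v = 0 \<and> g y v = 0" using face[OF ty(2)] by blast
    have fy: "f y \<in> topspace (realization K)" and gy: "g y \<in> topspace (realization K)"
      using f g ty(2) by (auto simp: continuous_map_into_realization)
    have finF: "finite F" using F(1) K unfolding abstract_complex_def by blast
    have sum1: "sum x F = 1" if x: "x \<in> topspace (realization K)" "\<forall>v. v \<notin> F \<longrightarrow> x v = 0" for x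
    proof -
      have "sum x F = sum x {v. x v \<noteq> 0}"
        by (rule sum.mono_neutral_right) (use finF x(2) in auto)
      then show ?thesis using x(1) by (simp add: realization_def)
    qed
    have "sum (?h (t, y)) F = (1 - t) * sum (f y) F + t * sum (g y) F"
      by (simp add: sum.distrib sum_distrib_left)
    also have "\<dots> = 1" using sum1[OF fy] sum1[OF gy] F(2) by simp
    finally have "sum (?h (t, y)) F = 1" .
    moreover have "\<forall>v. 0 \<le> ?h (t, y) v" using ty(1) fy gy by (auto simp: realization_def)
    ultimately show ?thesis
      unfolding in_topspace_realization[OF K] using F by (intro bexI[of _ F]) auto
  qed
  ultimately have "continuous_map (prod_topology (top_of_set {0..1}) Y) (realization K) ?h"
    unfolding continuous_map_into_realization by auto
  then show ?thesis
    unfolding homotopic_with_def using P by (intro exI[of _ ?h]) auto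
qed

section \<open>Complexes obtained from a cone by attaching cells\<close>

abbreviation support :: "('v \<Rightarrow> real) \<Rightarrow> 'v set" where
  "support x \<equiv> {v. x v \<noteq> 0}"

lemma realization_face:
  assumes "abstract_complex K" "x \<in> topspace (realization K)"
  shows "0 \<le> x v" "support x \<in> K" "finite (support x)" "sum x (support x) = 1"
  using assms by (auto simp: realization_def abstract_complex_def)

lemma sum_over_face:
  assumes "abstract_complex K" "x \<in> topspace (realization K)" "support x \<subseteq> F" "finite F"
  shows "sum x F = 1"
proof -
  have "sum x F = sum x (support x)"
    by (rule sum.mono_neutral_right) (use assms in auto)
  then show ?thesis using realization_face[OF assms(1,2)] by simp
qed

text \<open>What the quota inequalities provide, without weights. By maximality no proper subface of
  a face lies in \<open>S\<close>, so \<open>K - S\<close> is a subcomplex, a cone with apex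
  \<open>v0\<close>, and it contains the boundary of every cell.\<close>

locale cells_on_cone =
  fixes K :: "'v set set" and S :: "'v set set" and v0 :: 'v
  assumes complex: "abstract_complex K" and finite_K: "finite K"
    and S_sub: "S \<subseteq> K" and apex: "{v0} \<in> K"
    and S_max: "\<And>F G. \<lbrakk>F \<in> S; G \<in> K; F \<subseteq> G\<rbrakk> \<Longrightarrow> G = F"
    and cone: "\<And>F. \<lbrakk>F \<in> K; F \<notin> S\<rbrakk> \<Longrightarrow> insert v0 F \<in> K"
    and apex_notin: "\<And>F. F \<in> S \<Longrightarrow> v0 \<notin> F"
begin

lemma finite_S: "finite S"
  using finite_K S_sub by (rule finite_subset[rotated])

lemma cell: "F \<in> S \<Longrightarrow> finite F \<and> F \<noteq> {} \<and> 0 < card F"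
  using S_sub complex unfolding abstract_complex_def by (auto simp: card_gt_0_iff)

definition base_point :: "'v \<Rightarrow> real" where
  "base_point v = (if v = v0 then 1 else 0)"

section \<open>The homotopy that contracts the cone\<close>

text \<open>The amount taken off each coordinate in \<open>F\<close>. The barycentre has coordinates
  \<open>1 / card F\<close>; capping at half of that removes at most 1/2 in total, so the remainder
  can be renormalised.\<close>

definition cut :: "'v set \<Rightarrow> ('v \<Rightarrow> real) \<Rightarrow> real" where
  "cut F x = min (Min (x ` F)) (1 / (2 * real (card F)))"

text \<open>Radial expansion of every cell away from its barycentre: the inner half is stretched over
  the whole cell, the outer half is pushed to the boundary.\<close>

definition push :: "('v \<Rightarrow> real) \<Rightarrow> 'v \<Rightarrow> real" where
  "push x v = (x v - (\<Sum>F\<in>S. if v \<in> F then cut F x else 0)) / (1 - (\<Sum>F\<in>S. card F * cut F x))"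

text \<open>Equal to 1 on the cone and falling to 0 where the least coordinate in a cell reaches
  half of its value at the barycentre. Beyond this level \<open>push\<close> may stay inside the
  cell, where no segment to the apex is available.\<close>

definition height :: "('v \<Rightarrow> real) \<Rightarrow> real" where
  "height x = max 0 (1 - (\<Sum>F\<in>S. 2 * real (card F) * Min (x ` F)))"

definition contraction :: "('v \<Rightarrow> real) \<Rightarrow> 'v \<Rightarrow> real" where
  "contraction x v = (1 - height x) * push x v + height x * base_point v"

definition cone_part :: "('v \<Rightarrow> real) set" where
  "cone_part = {x \<in> topspace (realization K). support x \<notin> S}"

context
  fixes x assumes x: "x \<in> topspace (realization K)"
begin

text \<open>If all coordinates in \<open>F\<close> are positive, the support is a face containing
  \<open>F\<close>, hence \<open>F\<close> itself by maximality.\<close>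

lemma Min_cell_pos_iff:
  assumes "F \<in> S"
  shows "0 < Min (x ` F) \<longleftrightarrow> support x = F"
proof
  assume "0 < Min (x ` F)"
  then have "\<forall>v\<in>F. 0 < x v" using cell[OF assms] by simp
  then have "F \<subseteq> support x" by auto
  then show "support x = F" using S_max[OF assms] realization_face(2)[OF complex x] by blast
next
  assume F: "support x = F"
  then have "\<forall>v\<in>F. 0 < x v" using realization_face(1)[OF complex x] by (auto simp: less_le)
  then show "0 < Min (x ` F)" using cell[OF assms] by simp
qed

lemma Min_cell_nonneg: "F \<in> S \<Longrightarrow> 0 \<le> Min (x ` F)"
  using cell realization_face(1)[OF complex x] by simp

lemma Min_cell_eq_0: "\<lbrakk>F \<in> S; support x \<noteq> F\<rbrakk> \<Longrightarrow> Min (x ` F) = 0"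
  using Min_cell_pos_iff Min_cell_nonneg by (metis less_le)

lemma cut_eq_0: "\<lbrakk>F \<in> S; support x \<noteq> F\<rbrakk> \<Longrightarrow> cut F x = 0"
  by (simp add: cut_def Min_cell_eq_0)

text \<open>Open cells are disjoint, so a sum over all cells is a definition by cases in disguise.
  This is what makes \<open>push\<close>, \<open>height\<close> and later maps continuous without
  gluing.\<close>

lemma sum_cells:
  fixes g :: "'v set \<Rightarrow> real"
  assumes "\<And>F. \<lbrakk>F \<in> S; support x \<noteq> F\<rbrakk> \<Longrightarrow> g F = 0"
  shows "sum g S = (if support x \<in> S then g (support x) else 0)"
proof -
  have "sum g S = (\<Sum>F\<in>S. if F = support x then g F else 0)"
    using assms by (intro sum.cong) auto
  then show ?thesis using finite_S by (simp add: sum.delta)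
qed

lemma sum_cut:
  "(\<Sum>F\<in>S. card F * cut F x) = (if support x \<in> S then card (support x) * cut (support x) x else 0)"
  by (rule sum_cells) (simp add: cut_eq_0)

lemma cut_bounds:
  assumes "F \<in> S"
  shows "card F * cut F x \<le> 1 / 2" "v \<in> F \<Longrightarrow> cut F x \<le> x v"
proof -
  have c: "0 < real (card F)" using cell[OF assms] by simp
  have "cut F x \<le> 1 / (2 * real (card F))" by (simp add: cut_def)
  then have "card F * cut F x \<le> card F * (1 / (2 * real (card F)))" using c by (intro mult_left_mono) auto
  then show "card F * cut F x \<le> 1 / 2" using c by simp
  assume "v \<in> F"
  then have "Min (x ` F) \<le> x v" using cell[OF assms] by simp
  then show "cut F x \<le> x v" by (simp add: cut_def)
qed

lemma push_denominator_pos: "0 < 1 - (\<Sum>F\<in>S. card F * cut F x)"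
proof (cases "support x \<in> S")
  case True
  then show ?thesis using cut_bounds(1)[OF True] by (simp add: sum_cut)
qed (simp add: sum_cut)

lemma push_cone:
  assumes "support x \<notin> S"
  shows "push x = x"
proof
  fix v
  have "(\<Sum>F\<in>S. if v \<in> F then cut F x else 0) = 0"
    using cut_eq_0 assms by (intro sum.neutral) auto
  then show "push x v = x v" using assms by (simp add: push_def sum_cut)
qed

lemma push_cell:
  assumes "support x \<in> S"
  shows "push x v = (x v - (if v \<in> support x then cut (support x) x else 0)) /
    (1 - card (support x) * cut (support x) x)"
proof -
  have "(\<Sum>F\<in>S. if v \<in> F then cut F x else 0) = (if v \<in> support x then cut (support x) x else 0)"
    by (subst sum_cells) (use assms in \<open>auto simp: cut_eq_0\<close>)
  then show ?thesis using assms by (simp only: push_def sum_cut if_True)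
qed

lemma push_realization: "push x \<in> topspace (realization K)" and support_push: "support (push x) \<subseteq> support x"
proof -
  have "push x \<in> topspace (realization K) \<and> support (push x) \<subseteq> support x"
  proof (cases "support x \<in> S")
    case True
    let ?F = "support x" and ?c = "cut (support x) x"
    have pos: "0 < 1 - card ?F * ?c" using push_denominator_pos True by (simp add: sum_cut)
    have 0: "push x v = 0" if "v \<notin> ?F" for v using that by (simp add: push_cell[OF True])
    have nonneg: "0 \<le> push x v" for v
      using cut_bounds(2)[OF True, of v] pos realization_face(1)[OF complex x, of v]
      by (auto simp: push_cell[OF True] intro!: divide_nonneg_pos)
    have "sum (push x) ?F = (\<Sum>v\<in>?F. (x v - ?c) / (1 - card ?F * ?c))"
      by (intro sum.cong) (auto simp: push_cell[OF True])
    also have "\<dots> = (sum x ?F - card ?F * ?c) / (1 - card ?F * ?c)"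
      by (simp add: sum_subtractf flip: sum_divide_distrib)
    also have "\<dots> = 1" using pos realization_face(4)[OF complex x] by simp
    finally have "sum (push x) ?F = 1" .
    then show ?thesis
      unfolding in_topspace_realization[OF complex] using nonneg 0 realization_face(2)[OF complex x] by blast
  qed (use x in \<open>simp add: push_cone\<close>)
  then show "push x \<in> topspace (realization K)" "support (push x) \<subseteq> support x" by auto
qed

text \<open>Below the cap the whole minimum is subtracted, so a least coordinate becomes 0 and the
  point reaches the boundary of its cell. A proper subface is not in \<open>S\<close>, by
  maximality.\<close>

lemma support_push_notin:
  assumes "\<forall>F\<in>S. 2 * real (card F) * Min (x ` F) < 1"
  shows "support (push x) \<notin> S"
proof (cases "support x \<in> S")
  case True
  let ?F = "support x"
  have c: "0 < real (card ?F)" using cell[OF True] by simp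
  have "2 * real (card ?F) * Min (x ` ?F) < 1" using assms True by blast
  then have "Min (x ` ?F) < 1 / (2 * real (card ?F))" using c by (simp add: field_simps)
  then have m: "cut ?F x = Min (x ` ?F)" by (simp add: cut_def)
  have "Min (x ` ?F) \<in> x ` ?F" using cell[OF True] by (intro Min_in) auto
  then obtain v where v: "v \<in> ?F" "x v = Min (x ` ?F)" by (metis imageE)
  then have "push x v = 0" by (simp only: push_cell[OF True] m if_True diff_self div_0)
  then have "support (push x) \<noteq> ?F" using v(1) by blast
  then show ?thesis using S_max[of "support (push x)" ?F] support_push realization_face(2)[OF complex x] by blast
qed (simp add: push_cone)

lemma height_bounds: "0 \<le> height x" "height x \<le> 1"
proof -
  have "0 \<le> (\<Sum>F\<in>S. 2 * real (card F) * Min (x ` F))"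
    using Min_cell_nonneg by (intro sum_nonneg) auto
  then show "0 \<le> height x" "height x \<le> 1" by (auto simp: height_def)
qed

lemma height_pos:
  assumes "0 < height x" "F \<in> S"
  shows "2 * real (card F) * Min (x ` F) < 1"
proof -
  have "2 * real (card F) * Min (x ` F) \<le> (\<Sum>F\<in>S. 2 * real (card F) * Min (x ` F))"
    using assms(2) finite_S Min_cell_nonneg by (intro member_le_sum[of F S "\<lambda>F. 2 * real (card F) * Min (x ` F)"]) auto
  also have "\<dots> < 1" using assms(1) by (auto simp: height_def split: if_splits)
  finally show ?thesis .
qed

lemma height_cone:
  assumes "support x \<notin> S"
  shows "height x = 1"
proof -
  have "(\<Sum>F\<in>S. 2 * real (card F) * Min (x ` F)) = 0"
    using Min_cell_eq_0 assms by (intro sum.neutral) auto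
  then show ?thesis by (simp add: height_def)
qed

text \<open>Where \<open>height\<close> is positive, \<open>push x\<close> is in the cone, so the
  apex can be added to its support; where \<open>height\<close> is 0, both points coincide.\<close>

lemma contraction_face: "\<exists>F\<in>K. \<forall>v. v \<notin> F \<longrightarrow> push x v = 0 \<and> contraction x v = 0"
proof (cases "0 < height x")
  case True
  then have "support (push x) \<notin> S" using support_push_notin height_pos by blast
  then have "insert v0 (support (push x)) \<in> K"
    using cone realization_face(2)[OF complex push_realization] by blast
  then show ?thesis by (intro bexI) (auto simp: contraction_def base_point_def)
next
  case False
  then have "height x = 0" using height_bounds by simp
  then show ?thesis
    using realization_face(2)[OF complex push_realization] by (intro bexI) (auto simp: contraction_def)
qed

lemma contraction_realization: "contraction x \<in> topspace (realization K)"
proof -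
  obtain F where F: "F \<in> K" "\<forall>v. v \<notin> F \<longrightarrow> push x v = 0 \<and> contraction x v = 0"
    using contraction_face by blast
  show ?thesis
  proof (cases "height x = 0")
    case False
    have fin: "finite F" using F(1) complex unfolding abstract_complex_def by blast
    \<comment> \<open>The face obtained above is not known to contain the apex; this nonzero
      coordinate forces it to, so the base point has coordinate sum 1 over \<open>F\<close>.\<close>
    have "contraction x v0 \<noteq> 0"
      using False height_bounds realization_face(1)[OF complex push_realization, of v0]
      by (simp add: contraction_def base_point_def add_nonneg_eq_0_iff)
    then have "v0 \<in> F" using F(2) by blast
    then have b: "sum base_point F = 1" using fin by (simp add: base_point_def)
    have p: "sum (push x) F = 1"
      using sum_over_face[OF complex push_realization _ fin] F(2) by blast
    have "sum (contraction x) F = (1 - height x) * sum (push x) F + height x * sum base_point F"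
      by (simp add: contraction_def sum.distrib sum_distrib_left)
    then have "sum (contraction x) F = 1" using p b by simp
    moreover have "0 \<le> contraction x v" for v
      using height_bounds realization_face(1)[OF complex push_realization, of v]
      by (simp add: contraction_def base_point_def)
    ultimately show ?thesis
      unfolding in_topspace_realization[OF complex] using F by blast
  qed (simp add: contraction_def[abs_def] push_realization)
qed

end

lemma continuous_map_Min_cell:
  "F \<in> S \<Longrightarrow> continuous_map (realization K) euclideanreal (\<lambda>x. Min (x ` F))"
  using cell by (intro continuous_map_real_Min continuous_map_barycentric_coordinate) auto

lemma continuous_map_cut:
  "F \<in> S \<Longrightarrow> continuous_map (realization K) euclideanreal (cut F)"
  unfolding cut_def[abs_def] by (intro continuous_map_real_min continuous_map_Min_cell) auto

lemma continuous_map_push: "continuous_map (realization K) (realization K) push"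
proof -
  have "continuous_map (realization K) euclideanreal (\<lambda>x. if v \<in> F then cut F x else 0)" if "F \<in> S" for v F
    using continuous_map_cut[OF that] by (cases "v \<in> F") simp_all
  then have "continuous_map (realization K) euclideanreal (\<lambda>x. push x v)" for v
    unfolding push_def
    by (intro continuous_map_real_divide continuous_map_diff continuous_map_sum finite_S
        continuous_map_barycentric_coordinate continuous_map_real_mult_left continuous_map_cut)
      (use push_denominator_pos in \<open>auto simp: less_imp_neq[symmetric]\<close>)
  then show ?thesis using push_realization by (simp add: continuous_map_into_realization)
qed

lemma continuous_map_contraction: "continuous_map (realization K) (realization K) contraction"
proof -
  have "continuous_map (realization K) euclideanreal height"
    unfolding height_def[abs_def]
    by (intro continuous_map_real_max continuous_map_diff continuous_map_sum finite_S
        continuous_map_real_mult_left continuous_map_Min_cell) auto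
  moreover have "continuous_map (realization K) euclideanreal (\<lambda>x. push x v)" for v
    using continuous_map_push by (simp add: continuous_map_into_realization)
  ultimately have "continuous_map (realization K) euclideanreal (\<lambda>x. contraction x v)" for v
    unfolding contraction_def by (intro continuous_map_add continuous_map_real_mult continuous_map_diff
        continuous_map_real_mult_right) auto
  then show ?thesis using contraction_realization by (simp add: continuous_map_into_realization)
qed

lemma base_point_realization: "base_point \<in> topspace (realization K)"
  unfolding in_topspace_realization[OF complex] using apex
  by (intro bexI[of _ "{v0}"]) (auto simp: base_point_def)

lemma cone_partI:
  assumes "x \<in> topspace (realization K)" "F \<in> K" "F \<notin> S" "support x \<subseteq> F"
  shows "x \<in> cone_part"
  using assms S_max[of "support x" F] unfolding cone_part_def by auto

text \<open>The first stage fixes the cone pointwise. On the cone the second is the straight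
  contraction to the apex; it stays there because a face containing \<open>v0\<close> is not in
  \<open>S\<close>.\<close>

lemma homotopic_id_contraction:
  "homotopic_with (\<lambda>k. k ` cone_part \<subseteq> cone_part) (realization K) (realization K) id contraction"
proof (rule homotopic_with_trans)
  let ?P = "\<lambda>k. k ` cone_part \<subseteq> cone_part"
  show "homotopic_with ?P (realization K) (realization K) id push"
  proof (rule homotopic_with_segment[OF complex])
    fix x assume x: "x \<in> topspace (realization K)"
    show "\<exists>F\<in>K. \<forall>v. v \<notin> F \<longrightarrow> id x v = 0 \<and> push x v = 0"
      using realization_face(2)[OF complex x] support_push[OF x] by (intro bexI) auto
  next
    fix t :: real
    have "(\<lambda>v. (1 - t) * id x v + t * push x v) = x" if "x \<in> cone_part" for x
      using that push_cone by (auto simp: cone_part_def algebra_simps)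
    then show "?P (\<lambda>x v. (1 - t) * id x v + t * push x v)" by auto
  qed (auto simp: continuous_map_push)
  show "homotopic_with ?P (realization K) (realization K) push contraction"
  proof (rule homotopic_with_segment[OF complex continuous_map_push continuous_map_contraction contraction_face])
    fix t :: real assume t: "t \<in> {0..1}"
    show "?P (\<lambda>x v. (1 - t) * push x v + t * contraction x v)"
    proof (intro image_subsetI)
      fix x assume "x \<in> cone_part"
      then have x: "x \<in> topspace (realization K)" and nS: "support x \<notin> S" by (auto simp: cone_part_def)
      let ?y = "\<lambda>v. (1 - t) * push x v + t * contraction x v" and ?F = "insert v0 (support x)"
      have F: "?F \<in> K" using cone[OF realization_face(2)[OF complex x] nS] .
      have y: "?y v = (1 - t) * x v + t * base_point v" for v
        by (simp add: contraction_def push_cone[OF x nS] height_cone[OF x nS])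
      have "finite ?F" using realization_face(3)[OF complex x] by simp
      then have s: "sum x ?F = 1" "sum base_point ?F = 1"
        using sum_over_face[OF complex x] sum_over_face[OF complex base_point_realization]
        by (auto simp: base_point_def)
      have "sum ?y ?F = (1 - t) * sum x ?F + t * sum base_point ?F"
        unfolding y by (simp only: sum.distrib sum_distrib_left)
      then have "sum ?y ?F = 1" using s by simp
      moreover have "\<forall>v. 0 \<le> ?y v"
        unfolding y using t realization_face(1)[OF complex x] by (auto simp: base_point_def)
      moreover have out: "\<forall>v. v \<notin> ?F \<longrightarrow> ?y v = 0" unfolding y by (auto simp: base_point_def)
      ultimately have "?y \<in> topspace (realization K)"
        unfolding in_topspace_realization[OF complex] using F by blast
      moreover have "?F \<notin> S" using apex_notin by blast
      ultimately show "?y \<in> cone_part" using F out by (intro cone_partI) auto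
    qed
  qed
qed

lemma contraction_cone: "x \<in> cone_part \<Longrightarrow> contraction x = base_point"
  by (auto simp: cone_part_def contraction_def height_cone fun_eq_iff)

end

section \<open>The quotient map onto the bouquet\<close>

lemma openin_sphere_bouquet:
  "openin (sphere_bouquet d I) U \<longleftrightarrow> U \<subseteq> topspace (sphere_bouquet d I) \<and>
    (\<forall>i\<in>I. openin (nsphere (d i))
      {y \<in> topspace (nsphere (d i)). wedge_proj (\<lambda>_ k. if k = 0 then 1 else 0) (i, y) \<in> U})"
  unfolding sphere_bouquet_def openin_wedge topspace_wedge openin_sum_topology
  by (auto intro!: arg_cong2[where f = openin])

definition face_enum :: "'v set \<Rightarrow> nat \<Rightarrow> 'v" where
  "face_enum F = (SOME e. bij_betw e {..face_dim F} F)"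

lemma bij_betw_face_enum:
  assumes "finite F" "F \<noteq> {}"
  shows "bij_betw (face_enum F) {..face_dim F} F"
proof -
  have "card {..face_dim F} = card F" using assms by (simp add: face_dim_def card_gt_0_iff)
  then have "\<exists>e. bij_betw e {..face_dim F} F" using assms by (intro finite_same_card_bij) auto
  then show ?thesis unfolding face_enum_def by (rule someI_ex)
qed

context cells_on_cone
begin

text \<open>Defined on the whole realization and not just on one closed simplex: off the open cell
  the least coordinate is 0 and the value is the base point, so the complement of the open cell is
  collapsed.\<close>

definition cell_map :: "'v set \<Rightarrow> ('v \<Rightarrow> real) \<Rightarrow> nat \<Rightarrow> real" where
  "cell_map F x = simplex_to_sphere (face_dim F) (\<lambda>i. x (face_enum F i))"

definition collapse :: "('v \<Rightarrow> real) \<Rightarrow> ('v set \<times> (nat \<Rightarrow> real)) option" where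
  "collapse x = (if support x \<in> S then Some (support x, cell_map (support x) x) else None)"

lemma face_enum_cell:
  assumes "F \<in> S"
  shows "bij_betw (face_enum F) {..face_dim F} F"
    and "Min ((\<lambda>i. x (face_enum F i)) ` {..face_dim F}) = Min (x ` F)"
    and "(\<Sum>i\<le>face_dim F. x (face_enum F i)) = sum x F"
proof -
  show b: "bij_betw (face_enum F) {..face_dim F} F"
    using cell[OF assms] by (intro bij_betw_face_enum) auto
  have "(\<lambda>i. x (face_enum F i)) ` {..face_dim F} = x ` F"
    using bij_betw_imp_surj_on[OF b] by (metis image_image)
  then show "Min ((\<lambda>i. x (face_enum F i)) ` {..face_dim F}) = Min (x ` F)"
    by (rule arg_cong)
  show "(\<Sum>i\<le>face_dim F. x (face_enum F i)) = sum x F"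
    using b by (rule sum.reindex_bij_betw)
qed

lemma cell_map_boundary:
  assumes "x \<in> topspace (realization K)" "F \<in> S" "support x \<noteq> F"
  shows "cell_map F x = (\<lambda>k. if k = 0 then 1 else 0)"
  unfolding cell_map_def
  by (rule simplex_to_sphere_boundary)
    (simp only: face_enum_cell(2)[OF assms(2)] Min_cell_eq_0[OF assms])

lemma cell_map_interior:
  assumes "x \<in> topspace (realization K)" "support x \<in> S"
  shows "cell_map (support x) x \<noteq> (\<lambda>k. if k = 0 then 1 else 0)"
proof -
  have "cell_map (support x) x 0 < 1"
    unfolding cell_map_def
  proof (rule simplex_to_sphere_interior)
    show "0 < Min ((\<lambda>i. x (face_enum (support x) i)) ` {..face_dim (support x)})"
      unfolding face_enum_cell(2)[OF assms(2)] Min_cell_pos_iff[OF assms] by (rule refl)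
    show "(\<Sum>i\<le>face_dim (support x). x (face_enum (support x) i)) = 1"
      unfolding face_enum_cell(3)[OF assms(2)] by (rule realization_face(4)[OF complex assms(1)])
  qed
  then show ?thesis by (rule contrapos_pn) simp
qed

lemma continuous_map_cell_map:
  assumes "F \<in> S"
  shows "continuous_map (realization K) (nsphere (face_dim F)) (cell_map F)"
  unfolding cell_map_def[abs_def]
proof (rule continuous_map_simplex_to_sphere)
  fix x assume x: "x \<in> topspace (realization K)"
  show "Min ((\<lambda>i. x (face_enum F i)) ` {..face_dim F}) = 0 \<or> (\<Sum>i\<le>face_dim F. x (face_enum F i)) = 1"
    unfolding face_enum_cell(2,3)[OF assms]
    using Min_cell_eq_0[OF x assms] realization_face(4)[OF complex x] by blast
qed (rule continuous_map_barycentric_coordinate)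

lemma cell_map_surj:
  assumes F: "F \<in> S"
  shows "cell_map F ` topspace (realization K) = topspace (nsphere (face_dim F))"
proof
  show "cell_map F ` topspace (realization K) \<subseteq> topspace (nsphere (face_dim F))"
    using continuous_map_cell_map[OF F] by (auto simp: continuous_map_def)
  show "topspace (nsphere (face_dim F)) \<subseteq> cell_map F ` topspace (realization K)"
  proof
    fix p assume p: "p \<in> topspace (nsphere (face_dim F))"
    show "p \<in> cell_map F ` topspace (realization K)"
    proof (cases "p = (\<lambda>k. if k = 0 then 1 else 0)")
      case True
      \<comment> \<open>The apex lies in no cell, so it maps to the base point even when
        \<open>F\<close> is a single vertex, whose boundary is empty.\<close>
      have "support base_point = {v0}" by (auto simp: base_point_def)
      then have "support base_point \<noteq> F" using apex_notin[OF F] by auto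
      then have "cell_map F base_point = p"
        using cell_map_boundary[OF base_point_realization F] True by simp
      then show ?thesis using base_point_realization by blast
    next
      case False
      obtain y where y: "\<And>i. 0 < y i" "sum y {..face_dim F} = 1" "simplex_to_sphere (face_dim F) y = p"
        using simplex_to_sphere_surj[OF p False] by blast
      let ?e = "face_enum F"
      have b: "bij_betw ?e {..face_dim F} F" by (rule face_enum_cell(1)[OF F])
      define x where "x v = (if v \<in> F then y (inv_into {..face_dim F} ?e v) else 0)" for v
      have xe: "x (?e i) = y i" if "i \<le> face_dim F" for i
        using that bij_betwE[OF b] inv_into_f_f[OF bij_betw_imp_inj_on[OF b]] by (simp add: x_def)
      have "sum x F = (\<Sum>i\<le>face_dim F. x (?e i))" by (rule face_enum_cell(3)[OF F, symmetric])
      also have "\<dots> = sum y {..face_dim F}" by (intro sum.cong) (auto simp: xe)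
      also have "\<dots> = 1" by (rule y(2))
      finally have "x \<in> topspace (realization K)"
        unfolding in_topspace_realization[OF complex] using F S_sub y(1)
        by (intro bexI[of _ F]) (auto simp: x_def less_imp_le)
      moreover have "cell_map F x = p"
      proof -
        have "simplex_to_sphere (face_dim F) (\<lambda>i. x (?e i)) = simplex_to_sphere (face_dim F) y"
          by (rule simplex_to_sphere_cong) (rule xe)
        then show ?thesis using y(3) by (simp add: cell_map_def)
      qed
      ultimately show ?thesis by blast
    qed
  qed
qed

lemma cell_map_inj:
  assumes "x \<in> topspace (realization K)" "x' \<in> topspace (realization K)"
    and "support x = F" "support x' = F" "F \<in> S" "cell_map F x = cell_map F x'"
  shows "x = x'"
proof
  fix v
  show "x v = x' v"
  proof (cases "v \<in> F")
    case True
    then obtain i where i: "i \<le> face_dim F" "v = face_enum F i"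
      using bij_betw_imp_surj_on[OF face_enum_cell(1)[OF assms(5)]] by (metis atMost_iff imageE)
    have pos: "0 < Min ((\<lambda>i. z (face_enum F i)) ` {..face_dim F})"
      and one: "(\<Sum>i\<le>face_dim F. z (face_enum F i)) = 1"
      if z: "z \<in> topspace (realization K)" "support z = F" for z
    proof -
      show "0 < Min ((\<lambda>i. z (face_enum F i)) ` {..face_dim F})"
        unfolding face_enum_cell(2)[OF assms(5)] Min_cell_pos_iff[OF z(1) assms(5)] by (rule z(2))
      show "(\<Sum>i\<le>face_dim F. z (face_enum F i)) = 1"
        unfolding face_enum_cell(3)[OF assms(5)]
        using realization_face(4)[OF complex z(1)] unfolding z(2) .
    qed
    have "x (face_enum F i) = x' (face_enum F i)"
    proof (rule simplex_to_sphere_inj[OF _ _ _ _ _ i(1)])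
      show "simplex_to_sphere (face_dim F) (\<lambda>i. x (face_enum F i)) = simplex_to_sphere (face_dim F) (\<lambda>i. x' (face_enum F i))"
        using assms(6) by (simp only: cell_map_def)
    qed (rule pos[OF assms(1,3)] one[OF assms(1,3)] pos[OF assms(2,4)] one[OF assms(2,4)])+
    then show ?thesis by (simp add: i)
  next
    case False
    then have "x v = 0" "x' v = 0" using assms(3,4) by blast+
    then show ?thesis by simp
  qed
qed

text \<open>A continuous surjection from a compact space onto a Hausdorff space.\<close>

lemma quotient_map_cell_map:
  assumes "F \<in> S"
  shows "quotient_map (realization K) (nsphere (face_dim F)) (cell_map F)"
proof (rule continuous_imp_quotient_map)
  show "Hausdorff_space (nsphere (face_dim F))"
    unfolding nsphere_def by (intro Hausdorff_space_subtopology Hausdorff_Euclidean_space)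
qed (rule continuous_map_cell_map compact_space_realization complex finite_K cell_map_surj assms)+

lemma wedge_proj_cell_map:
  assumes "x \<in> topspace (realization K)" "F \<in> S"
  shows "wedge_proj (\<lambda>_ k. if k = 0 then 1 else 0) (F, cell_map F x) =
    (if support x = F then collapse x else None)"
proof (cases "support x = F")
  case True
  then have "cell_map F x \<noteq> (\<lambda>k. if k = 0 then 1 else 0)"
    using cell_map_interior[OF assms(1)] assms(2) by metis
  then have "wedge_proj (\<lambda>_ k. if k = 0 then 1 else 0) (F, cell_map F x) = Some (F, cell_map F x)"
    by (simp only: wedge_proj_def fst_conv snd_conv if_False)
  then show ?thesis using assms(2) by (simp only: collapse_def True if_True refl)
next
  case False
  then show ?thesis
    using cell_map_boundary[OF assms False] by (simp only: wedge_proj_def fst_conv snd_conv if_True if_False refl)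
qed

lemma collapse_surj: "collapse ` topspace (realization K) = topspace (sphere_bouquet face_dim S)"
proof -
  let ?w = "wedge_proj (\<lambda>_ k. if k = 0 then 1 else 0) :: 'v set \<times> (nat \<Rightarrow> real) \<Rightarrow> _"
  let ?T = "insert None (\<Union>F\<in>S. (\<lambda>y. ?w (F, y)) ` topspace (nsphere (face_dim F)))"
  have T: "topspace (sphere_bouquet face_dim S) = ?T"
    unfolding sphere_bouquet_def topspace_wedge by force
  have "collapse base_point = None"
    using apex_notin by (auto simp: collapse_def base_point_def)
  then have none: "None \<in> collapse ` topspace (realization K)" using base_point_realization by force
  have w: "?w (F, y) \<in> collapse ` topspace (realization K)"
    if F: "F \<in> S" and y: "y \<in> topspace (nsphere (face_dim F))" for F y
  proof -
    obtain x where "x \<in> topspace (realization K)" "y = cell_map F x" using y cell_map_surj[OF F] by blast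
    then show ?thesis
      using wedge_proj_cell_map[of x F] F none by (cases "support x = F") (simp_all only: if_True if_False imageI refl)
  qed
  have c: "collapse x \<in> ?T" if x: "x \<in> topspace (realization K)" for x
  proof (cases "support x \<in> S")
    case True
    then have "collapse x = ?w (support x, cell_map (support x) x)" unfolding wedge_proj_cell_map[OF x True] by simp
    moreover have "cell_map (support x) x \<in> topspace (nsphere (face_dim (support x)))"
      using cell_map_surj[OF True] x by blast
    ultimately show ?thesis using True by blast
  qed (simp add: collapse_def)
  show ?thesis
  proof (rule equalityI)
    show "collapse ` topspace (realization K) \<subseteq> topspace (sphere_bouquet face_dim S)"
      unfolding T using c by (rule image_subsetI)
    show "topspace (sphere_bouquet face_dim S) \<subseteq> collapse ` topspace (realization K)"
      unfolding T by (intro insert_subsetI none UN_least image_subsetI w)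
  qed
qed

text \<open>Openness in the bouquet is tested on each sphere, and each sphere is a quotient of the
  realization by its cell map. It remains to compare the preimages \<open>V F\<close>, one for each
  cell, with the preimage under \<open>collapse\<close>.\<close>

lemma quotient_map_collapse: "quotient_map (realization K) (sphere_bouquet face_dim S) collapse"
  unfolding quotient_map_def
proof (intro conjI allI impI collapse_surj)
  fix U assume U: "U \<subseteq> topspace (sphere_bouquet face_dim S)"
  let ?w = "wedge_proj (\<lambda>_ k. if k = 0 then 1 else 0) :: 'v set \<times> (nat \<Rightarrow> real) \<Rightarrow> _"
  let ?R = "realization K"
  let ?U = "{x \<in> topspace ?R. collapse x \<in> U}"
  define V where "V F = {x \<in> topspace ?R. ?w (F, cell_map F x) \<in> U}" for F
  have V: "openin ?R (V F) \<longleftrightarrow> openin (nsphere (face_dim F)) {y \<in> topspace (nsphere (face_dim F)). ?w (F, y) \<in> U}"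
    if F: "F \<in> S" for F
  proof -
    let ?W = "{y \<in> topspace (nsphere (face_dim F)). ?w (F, y) \<in> U}"
    have "V F = {x \<in> topspace ?R. cell_map F x \<in> ?W}"
      using cell_map_surj[OF F] by (auto simp: V_def)
    moreover have "?W \<subseteq> topspace (nsphere (face_dim F))" by blast
    then have "openin ?R {x \<in> topspace ?R. cell_map F x \<in> ?W} = openin (nsphere (face_dim F)) ?W"
      using quotient_map_cell_map[OF F] unfolding quotient_map_def by (elim conjE allE[of _ ?W] mp)
    ultimately show ?thesis by (simp only:)
  qed
  define sp where "sp x = support x" for x :: "'v \<Rightarrow> real"
  have VF: "V F = {x \<in> topspace ?R. (if sp x = F then collapse x else None) \<in> U}" if "F \<in> S" for F
    unfolding V_def sp_def
    by (intro Collect_cong conj_cong refl) (simp only: wedge_proj_cell_map[OF _ that])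
  have none: "collapse x = None" if "sp x \<notin> S" for x
    using that unfolding sp_def collapse_def by (rule if_not_P)
  define P where "P F = {x \<in> topspace ?R. sp x = F}" for F
  have P: "openin ?R (P F)" if F: "F \<in> S" for F
  proof -
    have "P F = {x \<in> topspace ?R. Min (x ` F) \<in> {0<..}}"
      unfolding P_def sp_def greaterThan_iff by (intro Collect_cong conj_cong refl Min_cell_pos_iff[OF _ F, symmetric])
    then show ?thesis
      using openin_continuous_map_preimage[OF continuous_map_Min_cell[OF F], of "{0<..}"] by simp
  qed
  \<comment> \<open>If \<open>U\<close> contains the common base point, \<open>V F\<close> is
    \<open>?U\<close> enlarged by the other open cells, and \<open>?U\<close> is the finite
    intersection of the \<open>V F\<close>. Otherwise \<open>V F\<close> is the part of
    \<open>?U\<close> in the open cell \<open>F\<close>, and \<open>?U\<close> is their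
    union.\<close>
  have "openin ?R ?U \<longleftrightarrow> (\<forall>F\<in>S. openin ?R (V F))"
  proof (cases "None \<in> U")
    case True
    have VF1: "V F = ?U \<union> (\<Union>G\<in>S - {F}. P G)" if F: "F \<in> S" for F
      using True unfolding VF[OF F] P_def by (auto simp: none split: if_splits)
    have "openin ?R (V F)" if "openin ?R ?U" "F \<in> S" for F
      unfolding VF1[OF that(2)] using that(1) P by (intro openin_Un openin_Union) auto
    moreover have "?U = (\<Inter>F\<in>S. V F) \<inter> topspace ?R"
    proof (intro equalityI subsetI)
      fix x assume "x \<in> (\<Inter>F\<in>S. V F) \<inter> topspace ?R"
      then show "x \<in> ?U" using True VF by (cases "sp x \<in> S") (auto simp: none)
    qed (use True VF in auto)
    then have "openin ?R ?U" if "\<forall>F\<in>S. openin ?R (V F)"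
      using that openin_INT[OF finite_S, of ?R V] by simp
    ultimately show ?thesis by blast
  next
    case False
    have VF1: "V F = ?U \<inter> P F" if "F \<in> S" for F
      using False unfolding VF[OF that] P_def by (auto split: if_splits)
    have "openin ?R (V F)" if "openin ?R ?U" "F \<in> S" for F
      unfolding VF1[OF that(2)] using that P by (intro openin_Int) auto
    moreover have "?U = (\<Union>F\<in>S. V F)"
    proof (intro equalityI subsetI)
      fix x assume x: "x \<in> ?U"
      then have "sp x \<in> S" using none False by force
      then show "x \<in> (\<Union>F\<in>S. V F)" using x VF by auto
    qed (use VF1 in auto)
    then have "openin ?R ?U" if "\<forall>F\<in>S. openin ?R (V F)"
      using that by (simp only:) (intro openin_Union, blast)
    ultimately show ?thesis by blast
  qed
  also have "\<dots> \<longleftrightarrow> openin (sphere_bouquet face_dim S) U"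
    unfolding openin_sphere_bouquet using U by (simp only: V simp_thms cong: ball_cong)
  finally show "openin ?R ?U = openin (sphere_bouquet face_dim S) U" .
qed

lemma homotopy_equivalent_bouquet:
  "realization K homotopy_equivalent_space sphere_bouquet face_dim S"
proof (rule homotopy_equivalent_quotient[OF quotient_map_collapse _ _ homotopic_id_contraction])
  fix x y assume x: "x \<in> topspace (realization K)" and y: "y \<in> topspace (realization K)"
    and eq: "collapse x = collapse y"
  show "x = y \<or> x \<in> cone_part \<and> y \<in> cone_part"
  proof -
    obtain F G where F: "support x = F" and G: "support y = G" by blast
    have "(if F \<in> S then Some (F, cell_map F x) else None) = (if G \<in> S then Some (G, cell_map G y) else None)"
      using eq unfolding collapse_def F G .
    then show ?thesis
      using cell_map_inj[OF x y F] G x y F unfolding cone_part_def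
      by (cases "F \<in> S"; cases "G \<in> S") simp_all
  qed
next
  fix x y assume "x \<in> cone_part" "y \<in> cone_part"
  then show "collapse x = collapse y" "contraction x = contraction y"
    by (simp_all only: contraction_cone) (simp add: collapse_def cone_part_def)
qed

section \<open>Two null-homotopic open sets\<close>

text \<open>On \<open>?U\<close> the map \<open>push\<close> leads into the cone, which contracts to
  the apex. On \<open>?V\<close> each open cell shrinks to one of its vertices, which then moves
  along an edge to the apex. A singleton in \<open>S\<close> would be an isolated point without such
  an edge.\<close>

lemma Cat_le_1:
  assumes "\<And>v. {v} \<notin> S"
  shows "Cat_le (realization K) 1"
proof -
  let ?R = "realization K"
  let ?U = "{x \<in> topspace ?R. \<forall>F\<in>S. 2 * real (card F) * Min (x ` F) < 1}"
  let ?V = "{x \<in> topspace ?R. support x \<in> S}"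
  \<comment> \<open>A continuous function that is positive exactly on the open cells; it exhibits
    \<open>?V\<close> as open and serves as a denominator on it.\<close>
  define m where "m x = (\<Sum>F\<in>S. Min (x ` F))" for x :: "'v \<Rightarrow> real"
  have m: "m x = (if support x \<in> S then Min (x ` support x) else 0)" if "x \<in> topspace ?R" for x
    unfolding m_def using Min_cell_eq_0[OF that] by (intro sum_cells[OF that])
  have mcont: "continuous_map ?R euclideanreal m"
    unfolding m_def by (intro continuous_map_sum finite_S continuous_map_Min_cell)
  have mpos: "0 < m x \<longleftrightarrow> support x \<in> S" if "x \<in> topspace ?R" for x
    using m[OF that] Min_cell_pos_iff[OF that] by auto
  have base: "continuous_map Y ?R (\<lambda>_. base_point)" for Y :: "('v \<Rightarrow> real) topology"
    using base_point_realization by simp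
  have "openin ?R ?U"
  proof -
    have "openin ?R {x \<in> topspace ?R. 2 * real (card F) * Min (x ` F) \<in> {..<1}}" if "F \<in> S" for F
      using that by (intro openin_continuous_map_preimage[where Y = euclideanreal] continuous_map_real_mult_left continuous_map_Min_cell) auto
    moreover have "?U = topspace ?R \<inter> (\<Inter>F\<in>S. {x \<in> topspace ?R. 2 * real (card F) * Min (x ` F) \<in> {..<1}})"
      by auto
    ultimately show ?thesis
      using finite_S by (cases "S = {}") (auto intro!: openin_Int openin_INT)
  qed
  moreover have "null_homotopic_in ?R ?U"
  proof -
    let ?Y = "subtopology ?R ?U"
    have "homotopic_with (\<lambda>_. True) ?Y ?R id push"
    proof (rule homotopic_with_segment[OF complex])
      fix x assume "x \<in> topspace ?Y"
      then have x: "x \<in> topspace ?R" by simp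
      show "\<exists>F\<in>K. \<forall>v. v \<notin> F \<longrightarrow> id x v = 0 \<and> push x v = 0"
        using realization_face(2)[OF complex x] support_push[OF x] by (intro bexI) auto
    qed (auto simp: id_def continuous_map_from_subtopology continuous_map_push)
    moreover have "homotopic_with (\<lambda>_. True) ?Y ?R push (\<lambda>_. base_point)"
    proof (rule homotopic_with_segment[OF complex _ base])
      fix x assume "x \<in> topspace ?Y"
      then have x: "x \<in> topspace ?R" "support (push x) \<notin> S" using support_push_notin by auto
      show "\<exists>F\<in>K. \<forall>v. v \<notin> F \<longrightarrow> push x v = 0 \<and> base_point v = 0"
        using cone[OF realization_face(2)[OF complex push_realization[OF x(1)]] x(2)]
        by (intro bexI) (auto simp: base_point_def)
    qed (auto simp: continuous_map_from_subtopology continuous_map_push)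
    ultimately show ?thesis
      unfolding null_homotopic_in_def by (blast intro: homotopic_with_trans)
  qed
  moreover have "openin ?R ?V"
  proof -
    have "?V = {x \<in> topspace ?R. m x \<in> {0<..}}" using mpos by auto
    then show ?thesis using openin_continuous_map_preimage[OF mcont, of "{0<..}"] by simp
  qed
  moreover have "null_homotopic_in ?R ?V"
  proof -
    let ?Y = "subtopology ?R ?V"
    define p where "p F = (SOME v. v \<in> F)" for F :: "'v set"
    have p: "p F \<in> F" if "F \<in> S" for F using cell[OF that] unfolding p_def by (simp add: some_in_eq)
    \<comment> \<open>On each open cell this is the constant map to the chosen vertex; as a quotient
      of sums over all cells it is continuous on their union.\<close>
    define c where "c x v = (\<Sum>F\<in>S. Min (x ` F) * (if v = p F then 1 else 0)) / m x" for x v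
    have c: "c x v = (if v = p (support x) then 1 else 0)" if "x \<in> topspace ?R" "support x \<in> S" for x v
    proof -
      have "(\<Sum>F\<in>S. Min (x ` F) * (if v = p F then 1 else 0)) =
          (if support x \<in> S then Min (x ` support x) * (if v = p (support x) then 1 else 0) else 0)"
        using Min_cell_eq_0[OF that(1)] by (intro sum_cells[OF that(1)]) auto
      then show ?thesis using that mpos[OF that(1)] m[OF that(1)] by (simp add: c_def)
    qed
    have pK: "{p F} \<in> K" if "F \<in> S" for F
      using p[OF that] S_sub complex that unfolding abstract_complex_def by blast
    have ccont: "continuous_map ?Y ?R c"
      unfolding continuous_map_into_realization
    proof (intro conjI allI Pi_I)
      fix v
      show "continuous_map ?Y euclideanreal (\<lambda>x. c x v)"
        unfolding c_def
        by (intro continuous_map_real_divide continuous_map_from_subtopology mcont continuous_map_sum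
            finite_S continuous_map_real_mult_right continuous_map_Min_cell)
          (use mpos in \<open>auto simp: less_imp_neq[symmetric]\<close>)
    next
      fix x assume "x \<in> topspace ?Y"
      then have x: "x \<in> topspace ?R" "support x \<in> S" by auto
      show "c x \<in> topspace ?R"
        unfolding in_topspace_realization[OF complex]
        by (intro bexI[OF _ pK[OF x(2)]]) (simp add: c[OF x])
    qed
    have "homotopic_with (\<lambda>_. True) ?Y ?R id c"
    proof (rule homotopic_with_segment[OF complex _ ccont])
      fix x assume "x \<in> topspace ?Y"
      then have x: "x \<in> topspace ?R" "support x \<in> S" by auto
      show "\<exists>F\<in>K. \<forall>v. v \<notin> F \<longrightarrow> id x v = 0 \<and> c x v = 0"
        using realization_face(2)[OF complex x(1)] p[OF x(2)] by (intro bexI) (auto simp: c[OF x])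
    qed (auto simp: id_def continuous_map_from_subtopology)
    moreover have "homotopic_with (\<lambda>_. True) ?Y ?R c (\<lambda>_. base_point)"
    proof (rule homotopic_with_segment[OF complex ccont base])
      fix x assume "x \<in> topspace ?Y"
      then have x: "x \<in> topspace ?R" "support x \<in> S" by auto
      show "\<exists>F\<in>K. \<forall>v. v \<notin> F \<longrightarrow> c x v = 0 \<and> base_point v = 0"
        \<comment> \<open>Since the chosen vertex is not itself a cell, it belongs to the cone and
          spans a face with the apex.\<close>
        using cone[OF pK[OF x(2)] assms] by (intro bexI) (auto simp: c[OF x] base_point_def)
    qed simp
    ultimately show ?thesis
      unfolding null_homotopic_in_def by (blast intro: homotopic_with_trans)
  qed
  moreover have "topspace ?R = ?U \<union> ?V"
  proof -
    have "2 * real (card F) * Min (x ` F) < 1"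
      if "x \<in> topspace ?R" "support x \<notin> S" "F \<in> S" for x F
    proof -
      have "support x \<noteq> F" using that(2,3) by metis
      then have "Min (x ` F) = 0" by (rule Min_cell_eq_0[OF that(1,3)])
      then show ?thesis by simp
    qed
    then show ?thesis by blast
  qed
  ultimately show ?thesis
    unfolding Cat_le_def
    by (intro exI[of _ "\<lambda>i. if i = 0 then ?U else ?V"]) (auto simp: atMost_Suc)
qed

end

section \<open>Neighbourhoods of subcomplexes\<close>

text \<open>Coordinates are lowered by \<open>e\<close>, cut off at 0 and renormalised. A point of
  \<open>N\<close> then has its support in a face of \<open>L\<close>. Supports only shrink, so the
  segment to the original point stays in one face of \<open>K\<close>. The map \<open>g\<close> need
  not fix the points of \<open>L\<close>.\<close>

lemma subcomplex_neighbourhood: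
  assumes K: "abstract_complex K" and fin: "finite (\<Union>K)" and L: "subcomplex L K"
  obtains N g where "openin (realization K) N" "topspace (realization L) \<subseteq> N"
    "continuous_map (subtopology (realization K) N) (realization L) g"
    "homotopic_with (\<lambda>_. True) (subtopology (realization K) N) (realization K) g id"
proof -
  let ?R = "realization K"
  define V where "V = \<Union>K"
  \<comment> \<open>Smaller than the average coordinate: values of at most \<open>e\<close> at all
    vertices could not add up to 1, so some coordinate survives and \<open>D\<close> is
    positive.\<close>
  define e where "e = 1 / (real (card V) + 1)"
  have e: "0 < e" by (simp add: e_def)
  have complex: "abstract_complex L" and sub: "L \<subseteq> K" using L by (simp_all add: subcomplex_def)
  have fin: "finite V" using fin by (simp add: V_def)
  define N where "N = {x \<in> topspace ?R. \<exists>F\<in>L. \<forall>v\<in>V - F. x v < e}"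
  define D where "D x = (\<Sum>u\<in>V. max 0 (x u - e))" for x :: "'a \<Rightarrow> real"
  define g where "g x v = max 0 (x v - e) / D x" for x v
  have supp: "support x \<subseteq> V" if "x \<in> topspace ?R" for x
    using realization_face(2)[OF K that] unfolding V_def by (rule Union_upper)
  have D: "0 < D x" if x: "x \<in> topspace ?R" for x
  proof -
    have "\<exists>u\<in>V. e < x u"
    proof (rule ccontr)
      assume "\<not> ?thesis"
      then have "sum x V \<le> (\<Sum>u\<in>V. e)" by (intro sum_mono) (meson not_less)
      also have "\<dots> < 1" by (simp add: e_def field_simps)
      finally show False using sum_over_face[OF K x supp[OF x] fin] by simp
    qed
    then obtain u where "u \<in> V" "e < x u" by blast
    then show ?thesis unfolding D_def using fin by (intro sum_pos2[of _ u]) auto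
  qed
  have Dcont: "continuous_map ?R euclideanreal D"
    unfolding D_def using fin
    by (intro continuous_map_sum continuous_map_real_max continuous_map_diff
        continuous_map_barycentric_coordinate) auto
  have "continuous_map ?R euclideanreal (\<lambda>x. g x v)" for v
    unfolding g_def using D
    by (intro continuous_map_real_divide Dcont continuous_map_real_max continuous_map_diff
        continuous_map_barycentric_coordinate) (auto simp: less_imp_neq[symmetric])
  then have gcont: "continuous_map (subtopology ?R N) euclideanreal (\<lambda>x. g x v)" for v
    by (rule continuous_map_from_subtopology)
  have "g x \<in> topspace (realization L)" if "x \<in> N" for x
  proof -
    have x: "x \<in> topspace ?R" and "\<exists>F\<in>L. \<forall>v\<in>V - F. x v < e"
      using that unfolding N_def by (simp_all only: mem_Collect_eq)
    then obtain F where F: "F \<in> L" "\<forall>v\<in>V - F. x v < e" by (elim bexE)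
    have out: "g x v = 0" if "v \<notin> F" for v
    proof -
      have "x v \<le> e"
      proof (cases "v \<in> V")
        case True
        then show ?thesis using F(2) that by (meson DiffI less_imp_le)
      next
        case False
        then have "x v = 0" using supp[OF x] by blast
        then show ?thesis using e by simp
      qed
      then show ?thesis by (simp add: g_def)
    qed
    have "F \<subseteq> V" using F(1) sub unfolding V_def by blast
    then have "sum (g x) F = sum (g x) V"
      using fin out by (intro sum.mono_neutral_left) auto
    also have "\<dots> = D x / D x" unfolding g_def D_def by (rule sum_divide_distrib[symmetric])
    also have "\<dots> = 1" using D[OF x] by simp
    finally have "sum (g x) F = 1" .
    moreover have "0 \<le> g x v" for v using D[OF x] by (simp add: g_def)
    ultimately show ?thesis unfolding in_topspace_realization[OF complex] using F(1) out by blast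
  qed
  then have g: "continuous_map (subtopology ?R N) (realization L) g"
    unfolding continuous_map_into_realization using gcont by auto
  have "openin ?R N"
  proof -
    have "openin ?R ((\<Inter>v\<in>V - F. {x \<in> topspace ?R. x v \<in> {..<e}}) \<inter> topspace ?R)" for F
      using fin by (intro openin_INT openin_continuous_map_preimage[where Y = euclideanreal]
          continuous_map_barycentric_coordinate) auto
    then have "openin ?R (\<Union>F\<in>L. (\<Inter>v\<in>V - F. {x \<in> topspace ?R. x v \<in> {..<e}}) \<inter> topspace ?R)"
      by (intro openin_Union) auto
    moreover have "N = (\<Union>F\<in>L. (\<Inter>v\<in>V - F. {x \<in> topspace ?R. x v \<in> {..<e}}) \<inter> topspace ?R)"
      unfolding N_def by auto
    ultimately show ?thesis by simp
  qed
  moreover have "topspace (realization L) \<subseteq> N"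
  proof
    fix x assume x: "x \<in> topspace (realization L)"
    then have "\<forall>v\<in>V - support x. x v < e" using e by simp
    moreover have "x \<in> topspace ?R" using realization_mono[OF sub] x by (rule subsetD)
    ultimately show "x \<in> N"
      unfolding N_def using realization_face(2)[OF complex x] by (intro CollectI conjI bexI)
  qed
  moreover have "homotopic_with (\<lambda>_. True) (subtopology ?R N) ?R g id"
  proof (rule homotopic_with_segment[OF K])
    show "continuous_map (subtopology ?R N) ?R g"
      using g realization_mono[OF sub] by (simp add: continuous_map_into_realization Pi_iff subset_iff)
    show "continuous_map (subtopology ?R N) ?R id"
      by (auto simp: id_def intro: continuous_map_from_subtopology)
    fix x assume "x \<in> topspace (subtopology ?R N)"
    then have x: "x \<in> topspace ?R" by simp
    show "\<exists>F\<in>K. \<forall>v. v \<notin> F \<longrightarrow> g x v = 0 \<and> id x v = 0"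
      using realization_face(2)[OF K x] e by (intro bexI) (auto simp: g_def)
  qed simp
  ultimately show thesis using g by (intro that)
qed

lemma Cat_le_Union_subcomplexes:
  assumes K: "abstract_complex K" and fin: "finite (\<Union>K)"
    and L: "\<And>j. j < k \<Longrightarrow> subcomplex (L j) K" and cover: "K \<subseteq> (\<Union>j<k. L j)"
    and Cat: "\<And>j. j < k \<Longrightarrow> Cat_le (realization (L j)) n" and k: "0 < k"
  shows "Cat_le (realization K) (k * Suc n - 1)"
proof -
  let ?R = "realization K"
  have "\<exists>N g. openin ?R N \<and> topspace (realization (L j)) \<subseteq> N \<and>
      continuous_map (subtopology ?R N) (realization (L j)) g \<and>
      homotopic_with (\<lambda>_. True) (subtopology ?R N) ?R g id" if j: "j < k" for j
    by (rule subcomplex_neighbourhood[OF K fin L[OF j]]) (intro exI conjI)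
  then obtain N g where Ng: "\<And>j. j < k \<Longrightarrow> openin ?R (N j) \<and> topspace (realization (L j)) \<subseteq> N j \<and>
      continuous_map (subtopology ?R (N j)) (realization (L j)) (g j) \<and>
      homotopic_with (\<lambda>_. True) (subtopology ?R (N j)) ?R (g j) id"
    by metis
  show ?thesis
  proof (rule Cat_le_cover[where X = "\<lambda>j. realization (L j)" and f = "\<lambda>_. id" and g = g and N = N])
    fix j assume j: "j < k"
    then have "L j \<subseteq> K" using L by (simp add: subcomplex_def)
    then show "continuous_map (realization (L j)) ?R id"
      using realization_mono[of "L j" K] continuous_map_barycentric_coordinate[of "L j"]
      by (simp add: continuous_map_into_realization subset_iff)
  next
    show "topspace ?R \<subseteq> (\<Union>j<k. N j)"
    proof
      fix x assume x: "x \<in> topspace ?R"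
      then obtain j where j: "j < k" "support x \<in> L j"
        using cover realization_face(2)[OF K x] by blast
      then have "x \<in> topspace (realization (L j))" using x by (simp add: realization_def)
      then show "x \<in> (\<Union>j<k. N j)" using Ng[OF j(1)] j(1) by blast
    qed
  qed (use Ng Cat k in auto)
qed

section \<open>Quota complexes\<close>

text \<open>Covers a coordinate whose quota is too small for any vertex, so that its complex is
  empty.\<close>

lemma Cat_le_empty:
  assumes "topspace X = {}"
  shows "Cat_le X n"
proof -
  have "subtopology X {} = trivial_topology" by simp
  \<comment> \<open>Any constant will do on the empty set, even one outside the space.\<close>
  then have "homotopic_with (\<lambda>_. True) (subtopology X {}) X id (\<lambda>_. undefined)"
    by (simp only:) (rule homotopic_with_equal, simp_all)
  then have "null_homotopic_in X {}"
    unfolding null_homotopic_in_def by (rule exI)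
  then show ?thesis unfolding Cat_le_def using assms by (intro exI[of _ "\<lambda>_. {}"]) simp
qed

lemma Cat_le_imp_le: "Cat_le X n \<Longrightarrow> Cat X \<le> enat n"
  unfolding Cat_def by (intro Inf_lower) simp

lemma abstract_complex_quota_complex:
  assumes "scalar_quota_system V w q"
  shows "abstract_complex (quota_complex V w q)"
  unfolding abstract_complex_def
proof (intro conjI ballI allI impI)
  fix F G assume F: "F \<in> quota_complex V w q" and G: "G \<subseteq> F \<and> G \<noteq> {}"
  have "sum w G \<le> sum w F"
    using F G assms by (intro sum_mono2) (auto simp: quota_complex_def scalar_quota_system_def less_imp_le)
  then show "G \<in> quota_complex V w q"
    using F G finite_subset[of G F] by (auto simp: quota_complex_def)
qed (auto simp: quota_complex_def)

text \<open>A face avoiding \<open>v0\<close> is a cell exactly when adding \<open>v0\<close>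
  reaches the quota. Adding any other vertex costs at least as much, so cells are maximal; this
  already places their boundaries in the cone.\<close>

lemma cells_on_cone_quota_complex:
  assumes sys: "scalar_quota_system V w q" and K: "K = quota_complex V w q" and fin: "finite K"
    and v0: "v0 \<in> vertices K" and min: "\<And>v. v \<in> vertices K \<Longrightarrow> w v0 \<le> w v"
  shows "cells_on_cone K {F \<in> K. v0 \<notin> F \<and> q - w v0 \<le> sum w F \<and> sum w F < q} v0"
proof
  show complex: "abstract_complex K" unfolding K by (rule abstract_complex_quota_complex[OF sys])
  show "{v0} \<in> K" using v0 by (simp add: vertices_def)
  then have v0V: "v0 \<in> V" by (simp add: K quota_complex_def)
  fix F G
  show "insert v0 F \<in> K" if F: "F \<in> K" "F \<notin> {F \<in> K. v0 \<notin> F \<and> q - w v0 \<le> sum w F \<and> sum w F < q}"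
  proof (cases "v0 \<in> F")
    case False
    have "finite F" "sum w F < q" using F(1) by (auto simp: K quota_complex_def)
    then have "sum w (insert v0 F) < q" using F False by auto
    then show ?thesis using F(1) v0V by (simp add: K quota_complex_def)
  qed (use F in \<open>simp add: insert_absorb\<close>)
  show "G = F" if F: "F \<in> {F \<in> K. v0 \<notin> F \<and> q - w v0 \<le> sum w F \<and> sum w F < q}"
    and G: "G \<in> K" "F \<subseteq> G"
  proof (rule ccontr)
    assume "G \<noteq> F"
    then obtain u where u: "u \<in> G" "u \<notin> F" using G by blast
    have finG: "finite G" "sum w G < q" "G \<subseteq> V" using G(1) by (auto simp: K quota_complex_def)
    have "{u} \<in> K" by (rule abstract_complex_subset[OF complex G(1)]) (use u in auto)
    then have "w v0 \<le> w u" using min by (simp add: vertices_def)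
    moreover have "sum w (insert u F) \<le> sum w G"
      using finG sys G u by (intro sum_mono2) (auto simp: scalar_quota_system_def less_imp_le)
    moreover have "sum w (insert u F) = w u + sum w F"
      using u(2) finite_subset[OF G(2) finG(1)] by (intro sum.insert)
    ultimately show False using F finG(2) by simp
  qed
qed (use fin in auto)

lemma quota_complex_bouquet:
  assumes "scalar_quota_system V w q" "K = quota_complex V w q" "finite K"
    "v0 \<in> vertices K" "\<And>v. v \<in> vertices K \<Longrightarrow> w v0 \<le> w v"
  shows "realization K homotopy_equivalent_space
    sphere_bouquet face_dim {F \<in> K. v0 \<notin> F \<and> q - w v0 \<le> sum w F \<and> sum w F < q}"
  by (rule cells_on_cone.homotopy_equivalent_bouquet[OF cells_on_cone_quota_complex[OF assms]])

text \<open>A singleton cell \<open>{v}\<close> would satisfy \<open>q - w v0 \<le> w v < q\<close>,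
  which makes \<open>v\<close> a shell vertex in this coordinate.\<close>

lemma Cat_le_quota_complex:
  assumes sys: "scalar_quota_system V w q" and fin: "finite V"
    and no_shell: "\<And>s. \<lbrakk>s \<in> V; q - Min (w ` V) \<le> w s\<rbrakk> \<Longrightarrow> q \<le> w s"
  shows "Cat_le (realization (quota_complex V w q)) 1"
proof (cases "quota_complex V w q = {}")
  case True
  then show ?thesis by (intro Cat_le_empty) (simp add: realization_def)
next
  case False
  let ?K = "quota_complex V w q"
  obtain F where F: "F \<in> ?K" using False by blast
  then obtain u where "u \<in> F" by (auto simp: quota_complex_def)
  then have u: "{u} \<in> ?K"
    by (intro abstract_complex_subset[OF abstract_complex_quota_complex[OF sys] F]) auto
  have V: "u \<in> V" "w u < q" using u by (auto simp: quota_complex_def)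
  have "Min (w ` V) \<in> w ` V" using fin V(1) by (intro Min_in) auto
  then obtain v0 where v0: "v0 \<in> V" "w v0 = Min (w ` V)" by (metis imageE)
  have le: "w v0 \<le> w v" if "v \<in> V" for v unfolding v0(2) using fin that by (intro Min_le) auto
  have "?K \<subseteq> Pow V" by (auto simp: quota_complex_def)
  then have finK: "finite ?K" using fin by (simp add: finite_subset)
  \<comment> \<open>The minimum over all of \<open>V\<close> is attained at a vertex of the complex:
    some \<open>u\<close> is below the quota and \<open>v0\<close> weighs no more.\<close>
  have "v0 \<in> vertices ?K" using v0(1) le[OF V(1)] V(2) by (simp add: vertices_def quota_complex_def)
  then interpret cells_on_cone ?K "{F \<in> ?K. v0 \<notin> F \<and> q - w v0 \<le> sum w F \<and> sum w F < q}" v0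
    using le by (intro cells_on_cone_quota_complex[OF sys refl finK]) (auto simp: vertices_def quota_complex_def)
  show ?thesis
  proof (rule Cat_le_1)
    fix v
    show "{v} \<notin> {F \<in> ?K. v0 \<notin> F \<and> q - w v0 \<le> sum w F \<and> sum w F < q}"
      using no_shell[of v] by (auto simp: quota_complex_def v0(2))
  qed
qed

section \<open>Vector valued quota complexes\<close>

lemma scalar_quota_system_coordinate:
  "\<lbrakk>vector_quota_system N V w q; j \<in> {1..N}\<rbrakk> \<Longrightarrow> scalar_quota_system V (w j) (q j)"
  by (simp add: vector_quota_system_def scalar_quota_system_def)

lemma vector_quota_complex_Union:
  "vector_quota_complex N V w q = (\<Union>j\<in>{1..N}. quota_complex V (w j) (q j))"
  by (auto simp: vector_quota_complex_def quota_complex_def)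

lemma abstract_complex_vector_quota_complex:
  assumes "vector_quota_system N V w q"
  shows "abstract_complex (vector_quota_complex N V w q)"
  unfolding abstract_complex_def
proof (intro conjI ballI allI impI)
  fix F G assume F: "F \<in> vector_quota_complex N V w q" and G: "G \<subseteq> F \<and> G \<noteq> {}"
  then obtain j where j: "j \<in> {1..N}" "F \<in> quota_complex V (w j) (q j)"
    unfolding vector_quota_complex_Union by (elim UN_E)
  have "G \<in> quota_complex V (w j) (q j)"
    using abstract_complex_quota_complex[OF scalar_quota_system_coordinate[OF assms j(1)]] j(2)
    by (rule abstract_complex_subset) (use G in auto)
  with j(1) show "G \<in> vector_quota_complex N V w q"
    unfolding vector_quota_complex_Union by (rule UN_I)
qed (auto simp: vector_quota_complex_def)

lemma Cat_vector_quota_complex: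
  assumes sys: "vector_quota_system N V w q" and no_shell: "\<nexists>s. shell_vertex N V w q s"
  shows "Cat (realization (vector_quota_complex N V w q)) \<le> enat (2 * N - 1)"
proof -
  let ?X = "vector_quota_complex N V w q"
  let ?L = "\<lambda>j. quota_complex V (w (Suc j)) (q (Suc j))"
  have N: "0 < N" and fin: "finite V" using sys by (auto simp: vector_quota_system_def)
  \<comment> \<open>The coordinates \<open>1..N\<close> are shifted to \<open>0..N-1\<close> to
    match the numbering of the cover.\<close>
  have X: "?X = (\<Union>j<N. ?L j)"
    unfolding vector_quota_complex_Union image_Suc_lessThan[symmetric] by (simp only: image_image)
  have coord: "scalar_quota_system V (w (Suc j)) (q (Suc j))" if "j < N" for j
    using that by (intro scalar_quota_system_coordinate[OF sys]) simp
  have "Cat_le (realization ?X) (N * Suc 1 - 1)"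
  proof (rule Cat_le_Union_subcomplexes[where L = ?L])
    show "abstract_complex ?X" by (rule abstract_complex_vector_quota_complex[OF sys])
    have "\<Union>?X \<subseteq> V" by (auto simp: vector_quota_complex_def)
    then show "finite (\<Union>?X)" using fin by (rule finite_subset)
    show "?X \<subseteq> (\<Union>j<N. ?L j)" by (simp add: X)
    fix j assume j: "j < N"
    show "subcomplex (?L j) ?X"
      unfolding subcomplex_def using abstract_complex_quota_complex[OF coord[OF j]] X j by blast
    show "Cat_le (realization (?L j)) 1"
    proof (rule Cat_le_quota_complex[OF coord[OF j] fin])
      fix s assume s: "s \<in> V" "q (Suc j) - Min (w (Suc j) ` V) \<le> w (Suc j) s"
      show "q (Suc j) \<le> w (Suc j) s"
      proof (rule ccontr)
        assume "\<not> ?thesis"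
        then have "shell_vertex N V w q s"
          unfolding shell_vertex_def using s j by (intro conjI bexI[of _ "Suc j"]) auto
        then show False using no_shell by blast
      qed
    qed
  qed (rule N)
  then have "Cat_le (realization ?X) (2 * N - 1)" by (simp add: mult_2)
  then show ?thesis by (rule Cat_le_imp_le)
qed

text \<open>The condition \<open>1 \<le> N\<close> keeps the subtraction of natural numbers exact;
  for \<open>N = 0\<close> it would truncate to 0 and the inequality would fail at
  \<open>c = 0\<close>.\<close>

lemma ereal_of_enat_half_le:
  assumes "c \<le> enat (2 * N - 1)" "1 \<le> N"
  shows "(ereal_of_enat c + 1) / 2 \<le> ereal (real N)"
proof -
  obtain m where m: "c = enat m" "m \<le> 2 * N - 1" using assms(1) by (cases c) auto
  have "(ereal_of_enat c + 1) / 2 = ereal ((real m + 1) / 2)"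
    by (simp add: m(1) one_ereal_def)
  also have "real m + 1 \<le> 2 * real N" using m(2) assms(2) by linarith
  then have "ereal ((real m + 1) / 2) \<le> ereal (real N)" by simp
  finally show ?thesis .
qed

theorem theorem1p3:
  shows
   "(\<forall>(V :: 'a set) w q X v0.
       scalar_quota_system V w q \<and> X = quota_complex V w q \<and> finite X \<and> X \<noteq> {} \<and>
       v0 \<in> vertices X \<and> (\<forall>v\<in>vertices X. w v0 \<le> w v) \<longrightarrow>
       realization X homotopy_equivalent_space
         sphere_bouquet face_dim {F \<in> X. v0 \<notin> F \<and> q - w v0 \<le> sum w F \<and> sum w F < q})
    \<and>
    (\<forall>N (V :: 'b set) w q X.
       vector_quota_system N V w q \<and> X = vector_quota_complex N V w q \<longrightarrow>
       (\<exists>K. (\<forall>j\<in>{1..N}. is_scalar_quota_complex (K j) \<and> subcomplex (K j) X) \<and>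
            X = (\<Union>j\<in>{1..N}. K j)) \<and>
       ((\<nexists>s. shell_vertex N V w q s) \<longrightarrow> Cat (realization X) \<le> enat (2 * N - 1)) \<and>
       (\<forall>Y :: 'c topology. realization X homotopy_equivalent_space Y \<longrightarrow>
          (ereal_of_enat (Cat Y) + 1) / 2 = (ereal_of_enat (Cat (realization X)) + 1) / 2) \<and>
       (\<forall>N' (V' :: 'b set) w' q'.
          vector_quota_system N' V' w' q' \<and> (\<nexists>s. shell_vertex N' V' w' q' s) \<and>
          vector_quota_complex N' V' w' q' = X \<longrightarrow>
          (ereal_of_enat (Cat (realization X)) + 1) / 2 \<le> ereal (real N')))"
proof (intro conjI allI impI)
  fix V :: "'a set" and w q X v0
  assume "scalar_quota_system V w q \<and> X = quota_complex V w q \<and> finite X \<and> X \<noteq> {} \<and>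
       v0 \<in> vertices X \<and> (\<forall>v\<in>vertices X. w v0 \<le> w v)"
  then show "realization X homotopy_equivalent_space
         sphere_bouquet face_dim {F \<in> X. v0 \<notin> F \<and> q - w v0 \<le> sum w F \<and> sum w F < q}"
    by (elim conjE) (rule quota_complex_bouquet, simp_all)
next
  fix N and V :: "'b set" and w q X
  assume "vector_quota_system N V w q \<and> X = vector_quota_complex N V w q"
  then have sys: "vector_quota_system N V w q" and X: "X = vector_quota_complex N V w q" by auto
  let ?K = "\<lambda>j. quota_complex V (w j) (q j)"
  have "is_scalar_quota_complex (?K j)" if "j \<in> {1..N}" for j
    unfolding is_scalar_quota_complex_def using scalar_quota_system_coordinate[OF sys that] by blast
  moreover have "subcomplex (?K j) X" if "j \<in> {1..N}" for j
    unfolding subcomplex_def X vector_quota_complex_Union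
    using abstract_complex_quota_complex[OF scalar_quota_system_coordinate[OF sys that]] that by blast
  ultimately show "\<exists>K. (\<forall>j\<in>{1..N}. is_scalar_quota_complex (K j) \<and> subcomplex (K j) X) \<and>
            X = (\<Union>j\<in>{1..N}. K j)"
    by (intro exI[of _ ?K]) (simp add: X vector_quota_complex_Union)
  show "Cat (realization X) \<le> enat (2 * N - 1)" if "\<nexists>s. shell_vertex N V w q s"
    unfolding X by (rule Cat_vector_quota_complex[OF sys that])
  show "(ereal_of_enat (Cat Y) + 1) / 2 = (ereal_of_enat (Cat (realization X)) + 1) / 2"
    if "realization X homotopy_equivalent_space Y" for Y :: "'c topology"
    using Cat_homotopy_equivalent[OF that] by simp
  fix N' and V' :: "'b set" and w' q'
  assume "vector_quota_system N' V' w' q' \<and> (\<nexists>s. shell_vertex N' V' w' q' s) \<and>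
          vector_quota_complex N' V' w' q' = X"
  then have sys': "vector_quota_system N' V' w' q'" and ns: "\<nexists>s. shell_vertex N' V' w' q' s"
    and X': "vector_quota_complex N' V' w' q' = X" by auto
  \<comment> \<open>The category depends on \<open>X\<close> alone, so the bound can be read off
    from this second presentation, which is the one assumed to have no shell vertices.\<close>
  show "(ereal_of_enat (Cat (realization X)) + 1) / 2 \<le> ereal (real N')"
    using Cat_vector_quota_complex[OF sys' ns] sys'
    unfolding X' by (intro ereal_of_enat_half_le) (auto simp: vector_quota_system_def)
qed

end
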